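(* Let $X$ be a finite simplicial complex on vertex set $V$, and let $V_1,\dots,V_m$ be a partition of $V$. For $I\subset\{1,\dots,m\}$ write $V_I=\bigcup_{i\in I}V_i$ and let $X[V_I]=\{\sigma\in X:\sigma\subset V_I\}$ be the induced subcomplex on vertex set $V_I$. If for every $\emptyset\ne I\subset\{1,2,\dots,m\}$ $$\Gamma(X[V_I])>\sum_{r\in J_{X[V_I]}} r\binom{|I|-1}{r},$$ then $X$ has a colorful simplex, i.e. there is $\sigma\in X$ with $|\sigma\cap V_i|=1$ for all $i\in\{1,\dots,m\}$.
   Context: A finite simplicial complex $X$ on a finite vertex set $V$ is a downward closed family of subsets of $V$ containing $\emptyset$ and every singleton $\{v\}$, $v\in V$; $\dim\sigma=|\sigma|-1$. A set $\sigma\subset V$ is a missing face of $X$ if $\sigma\notin X$ but every proper subset of $\sigma$ belongs to $X$. For vertices $v,w$ and a set $\sigma$, write $vw\sigma=\{v,w\}\cup\sigma$. Vector domination number of a complex $X$ on vertex set $V$: let $\mathcal M_i(X)$ be the set of missing faces of $X$ of dimension $i$, $J_X=\{i:\mathcal M_i(X)\ne\emptyset\}$, and $S(X)=\bigcup_{i\in J_X}\binom{V}{i-1}$, where $\binom{V}{j}$ is the set of $j$-element subsets of $V$. For $\sigma\in S(X)$, a vector representation of $X$ with respect to $\sigma$ is a map $P_\sigma:V\to\mathbb R^{\ell}$ (for some $\ell=\ell(\sigma)\in\mathbb N$) such that $P_\sigma(v)\cdot P_\sigma(w)\ge 1$ if $vw\sigma\in\mathcal M_{|\sigma|+1}(X)$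 and $P_\sigma(v)\cdot P_\sigma(w)\ge 0$ otherwise ($v,w\in V$). Identify $P_\sigma$ with the $|V|\times\ell$ matrix whose rows are the vectors $P_\sigma(v)$. A vector representation of $X$ is a collection $P=\{P_\sigma:\sigma\in S(X)\}$ of such maps. A family of non-negative (row) vectors $\{\alpha_\sigma\in\mathbb R^V:\sigma\in S(X)\}$ is dominating for $P$ if $\sum_{\sigma\in S(X)}\alpha_\sigma P_\sigma P_\sigma^T\ge\mathbf 1$ coordinatewise, where $\mathbf 1$ is the all-ones vector. The value of $P$ is $|P|=\min\{\sum_{\sigma\in S(X)}\alpha_\sigma\cdot\mathbf 1:\{\alpha_\sigma\}\text{ dominating for }P\}$ ($+\infty$ if there is no dominating family). $\Gamma(X)$ is the supremum of $|P|$ over all vector representations $P$ of $X$. An empty sum is $0$. *)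

theory Defs
  imports
    Complex_Main
    "HOL-Library.Extended_Real"
    "HOL-Library.Disjoint_Sets"
    "Jordan_Normal_Form.Matrix"
begin

definition finite_complex :: "'a set \<Rightarrow> 'a set set \<Rightarrow> bool" where
  "finite_complex V X \<longleftrightarrow>
     finite V \<and> X \<subseteq> Pow V \<and> {} \<in> X \<and> (\<forall>v\<in>V. {v} \<in> X) \<and>
     (\<forall>\<sigma>\<in>X. \<forall>\<tau>. \<tau> \<subseteq> \<sigma> \<longrightarrow> \<tau> \<in> X)"

definition induced_complex :: "'a set set \<Rightarrow> 'a set \<Rightarrow> 'a set set" where
  "induced_complex X W = {\<sigma> \<in> X. \<sigma> \<subseteq> W}"

definition missing_face :: "'a set \<Rightarrow> 'a set set \<Rightarrow> 'a set \<Rightarrow> bool" where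
  "missing_face V X \<sigma> \<longleftrightarrow> \<sigma> \<subseteq> V \<and> \<sigma> \<notin> X \<and> (\<forall>\<tau>. \<tau> \<subset> \<sigma> \<longrightarrow> \<tau> \<in> X)"

text \<open>A face of dimension \<open>i\<close> has \<open>i + 1\<close> elements.\<close>

definition missing_faces :: "'a set \<Rightarrow> 'a set set \<Rightarrow> nat \<Rightarrow> 'a set set" where
  "missing_faces V X i = {\<sigma>. missing_face V X \<sigma> \<and> card \<sigma> = i + 1}"

definition missing_dims :: "'a set \<Rightarrow> 'a set set \<Rightarrow> nat set" where
  "missing_dims V X = {i. missing_faces V X i \<noteq> {}}"

text \<open>In a complex the empty set and all singletons are faces, so \<open>0\<close> is not the dimension of a
  missing face and the subtraction below never truncates.\<close>

definition rep_index :: "'a set \<Rightarrow> 'a set set \<Rightarrow> 'a set set" where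
  "rep_index V X = (\<Union>i\<in>missing_dims V X. {\<sigma>. \<sigma> \<subseteq> V \<and> card \<sigma> = i - 1})"

text \<open>The length of the vectors may depend on \<open>\<sigma>\<close>.  The case \<open>v = w\<close> is included.\<close>

definition vector_rep_at ::
    "'a set \<Rightarrow> 'a set set \<Rightarrow> 'a set \<Rightarrow> ('a \<Rightarrow> real vec) \<Rightarrow> bool" where
  "vector_rep_at V X \<sigma> p \<longleftrightarrow>
     (\<exists>l. \<forall>v\<in>V. p v \<in> carrier_vec l) \<and>
     (\<forall>v\<in>V. \<forall>w\<in>V.
        if {v, w} \<union> \<sigma> \<in> missing_faces V X (card \<sigma> + 1)
        then scalar_prod (p v) (p w) \<ge> 1
        else scalar_prod (p v) (p w) \<ge> 0)"

definition vector_rep ::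
    "'a set \<Rightarrow> 'a set set \<Rightarrow> ('a set \<Rightarrow> 'a \<Rightarrow> real vec) \<Rightarrow> bool" where
  "vector_rep V X P \<longleftrightarrow> (\<forall>\<sigma>\<in>rep_index V X. vector_rep_at V X \<sigma> (P \<sigma>))"

text \<open>The \<open>(v, w)\<close> entry of the matrix \<open>P\<^sub>\<sigma> P\<^sub>\<sigma>\<^sup>T\<close> is the scalar product of \<open>P \<sigma> v\<close> and
  \<open>P \<sigma> w\<close>; the double sum is the coordinate at \<open>w\<close> of the sum of the row vectors
  \<open>\<alpha>\<^sub>\<sigma> P\<^sub>\<sigma> P\<^sub>\<sigma>\<^sup>T\<close>.\<close>

definition dominating ::
    "'a set \<Rightarrow> 'a set set \<Rightarrow> ('a set \<Rightarrow> 'a \<Rightarrow> real vec) \<Rightarrow> ('a set \<Rightarrow> 'a \<Rightarrow> real) \<Rightarrow> bool" where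
  "dominating V X P \<alpha> \<longleftrightarrow>
     (\<forall>\<sigma>\<in>rep_index V X. \<forall>v\<in>V. \<alpha> \<sigma> v \<ge> 0) \<and>
     (\<forall>w\<in>V. (\<Sum>\<sigma>\<in>rep_index V X. \<Sum>v\<in>V. \<alpha> \<sigma> v * scalar_prod (P \<sigma> v) (P \<sigma> w)) \<ge> 1)"

text \<open>The value of a representation is the optimum of a linear program; the infimum is attained
  when there is a dominating family, and is \<open>\<infinity>\<close> when there is none.\<close>

definition rep_value :: "'a set \<Rightarrow> 'a set set \<Rightarrow> ('a set \<Rightarrow> 'a \<Rightarrow> real vec) \<Rightarrow> ereal" where
  "rep_value V X P =
     (INF \<alpha>\<in>{\<alpha>. dominating V X P \<alpha>}. ereal (\<Sum>\<sigma>\<in>rep_index V X. \<Sum>v\<in>V. \<alpha> \<sigma> v))"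

definition vector_domination :: "'a set \<Rightarrow> 'a set set \<Rightarrow> ereal" where
  "vector_domination V X = (SUP P\<in>{P. vector_rep V X P}. rep_value V X P)"

end

theory Submission
  imports Defs
begin

text \<open>
A colourful simplex is produced topologically. Write \<open>X\<^sub>I\<close> for the subcomplex induced on
the union \<open>V\<^sub>I\<close> of the colour classes in \<open>I\<close>. If every \<open>X\<^sub>I\<close> with
\<open>I \<noteq> {}\<close> has vanishing reduced real homology in dimension \<open>|I| - 2\<close>, then chains
\<open>c\<^sub>I\<close> of dimension \<open>|I| - 1\<close> in \<open>X\<^sub>I\<close> can be chosen by induction on
\<open>|I|\<close> so that the boundary of \<open>c\<^sub>I\<close> is the alternating sum of the \<open>c\<close>'s of the facets
of \<open>I\<close>; this is a chain map from a full simplex on the colours to \<open>X\<close>. Counting, with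
coefficients, the simplices of \<open>c\<^sub>I\<close> that meet each colour of \<open>I\<close> exactly once gives \<open>1\<close>
for every \<open>I\<close>, because the count does not change on passing to a facet and it is \<open>1\<close> for the
empty set of colours. So some simplex of \<open>X\<close> is rainbow for the set of all colours
(\<open>rainbow_simplex_exists\<close>).

The homology vanishes for a spectral reason (\<open>cycle_is_boundary\<close>). Give each vertex a positive weight
\<open>x v\<close> and each face the product of the weights of its vertices. A cycle that is not a boundary
leaves a nonzero residual after projection to the space of boundaries; divided by the face weights, it is a
nonzero harmonic cochain \<open>\<phi>\<close>. Expanding the weighted norm of the coboundary of
\<open>\<phi>\<close> gives diagonal terms and, for each face \<open>\<eta>\<close> of codimension one, a sum over
pairs of vertices \<open>v, u\<close> that extend \<open>\<eta>\<close> jointly. Being coclosed turns this into diagonal terms and a sum over pairs that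
do not extend \<open>\<eta>\<close> jointly, that is, pairs for which a missing face \<open>{v, u} \<union> \<sigma>\<close> with
\<open>\<sigma> \<subseteq> \<eta>\<close> exists. The indicator of such pairs is bounded above by the sum of the Gram
matrices \<open>P\<^sub>\<sigma> P\<^sub>\<sigma>\<^sup>T\<close> over \<open>\<sigma> \<subseteq> \<eta>\<close>. Each Gram matrix is positive semidefinite, so it
contributes with the right sign, and the excess over the indicator is a nonnegative symmetric
matrix whose quadratic form is controlled by its row sums (\<open>link_estimate\<close>). If
\<open>P\<^sub>\<sigma> P\<^sub>\<sigma>\<^sup>T x \<le> 1\<close> for all \<open>\<sigma>\<close>, all terms add up to
\<open>0 \<ge> (|x| - \<Sum>r. r * (k + 1 choose r))\<close> times the squared norm of \<open>\<phi>\<close>, where \<open>|x|\<close> is the total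
weight and \<open>k\<close> is the dimension, so a large total weight forces \<open>\<phi> = 0\<close>.

Weights of this kind are the positive feasible solutions of the linear program dual to the one that
defines the value of \<open>P\<close>. Hence a large vector domination number supplies them
(\<open>vector_domination_dual_weights\<close>), by linear programming duality (\<open>lp_duality\<close>), for which
an elimination argument suffices.
\<close>

section \<open>Linear programming duality\<close>

text \<open>The combinations with nonnegative coefficients that are not all zero. Generating them inductively
makes nested combinations (combinations of combinations) immediate, which elimination needs.\<close>

inductive_set pos_comb :: "('c \<Rightarrow> real) set \<Rightarrow> ('c \<Rightarrow> real) set" for F where
  gen: "f \<in> F \<Longrightarrow> f \<in> pos_comb F"
| add: "f \<in> pos_comb F \<Longrightarrow> g \<in> pos_comb F \<Longrightarrow> (\<lambda>c. f c + g c) \<in> pos_comb F"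
| scale: "f \<in> pos_comb F \<Longrightarrow> t > 0 \<Longrightarrow> (\<lambda>c. t * f c) \<in> pos_comb F"

lemma pos_comb_subset:
  assumes "h \<in> pos_comb G" "G \<subseteq> pos_comb F"
  shows "h \<in> pos_comb F"
  using assms(1)
proof induction
  case (gen f)
  then show ?case using assms(2) by blast
next
  case (add f g)
  from add.IH show ?case by (rule pos_comb.add)
next
  case (scale f t)
  from scale.IH scale.hyps(2) show ?case by (rule pos_comb.scale)
qed

lemma real_between_finite_sets:
  fixes L U :: "real set"
  assumes "finite L" "finite U" and less: "\<And>l u. l \<in> L \<Longrightarrow> u \<in> U \<Longrightarrow> l < u"
  shows "\<exists>t. (\<forall>l\<in>L. l < t) \<and> (\<forall>u\<in>U. t < u)"
proof (cases "L = {} \<or> U = {}")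
  case True
  have "\<forall>l\<in>L. l < Max L + 1" "\<forall>u\<in>U. Min U - 1 < u"
    using Max_ge[OF assms(1)] Min_le[OF assms(2)] by force+
  with True show ?thesis by blast
next
  case False
  then have "Max L < Min U" using assms by simp
  then obtain t where "Max L < t" "t < Min U" using dense by blast
  then show ?thesis using assms(1,2) False by (intro exI[of _ t]) auto
qed

text \<open>Gordan's theorem of the alternative, by Fourier--Motzkin elimination of one variable: every
pair of inequalities with coefficients of opposite signs at \<open>k\<close> is replaced by the positive combination in which
\<open>k\<close> cancels.\<close>

lemma gordan_alternative:
  fixes F :: "('c \<Rightarrow> real) set"
  assumes "finite C" "finite F"
  shows "(\<exists>x. \<forall>f\<in>F. (\<Sum>c\<in>C. f c * x c) < 0) \<or> (\<exists>h\<in>pos_comb F. \<forall>c\<in>C. h c = 0)"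
  using assms
proof (induction C arbitrary: F rule: finite_induct)
  case empty
  then show ?case by (cases "F = {}") (auto intro: pos_comb.gen)
next
  case (insert k C)
  define P where "P = {f\<in>F. f k > 0}"
  define N where "N = {f\<in>F. f k < 0}"
  define Z where "Z = {f\<in>F. f k = 0}"
  define mix where "mix = (\<lambda>(f, g) c. f k * g c + (- g k) * f c :: real)"
  define G where "G = Z \<union> mix ` (P \<times> N)"
  have fin: "finite P" "finite N" "finite G"
    using insert.prems by (auto simp: P_def N_def Z_def G_def)
  have G_F: "G \<subseteq> pos_comb F"
  proof
    fix h assume "h \<in> G"
    then consider "h \<in> Z" | f g where "f \<in> P" "g \<in> N" "h = mix (f, g)" by (auto simp: G_def)
    then show "h \<in> pos_comb F"
    proof cases
      case 1 then show ?thesis by (auto simp: Z_def intro: pos_comb.gen)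
    next
      case 2
      have "f \<in> pos_comb F" "g \<in> pos_comb F" "f k > 0" "- g k > 0"
        using 2 by (auto simp: P_def N_def intro: pos_comb.gen)
      then have "(\<lambda>c. f k * g c) \<in> pos_comb F" "(\<lambda>c. (- g k) * f c) \<in> pos_comb F"
        by (simp_all only: pos_comb.scale)
      then show ?thesis unfolding 2(3) mix_def prod.case by (rule pos_comb.add)
    qed
  qed
  have G_k: "h k = 0" if "h \<in> pos_comb G" for h
    using that by induction (auto simp: G_def Z_def mix_def)
  from insert.IH[OF fin(3)] show ?case
  proof
    assume "\<exists>x. \<forall>f\<in>G. (\<Sum>c\<in>C. f c * x c) < 0"
    then obtain x where x: "\<And>f. f \<in> G \<Longrightarrow> (\<Sum>c\<in>C. f c * x c) < 0" by blast
    define s where "s f = (\<Sum>c\<in>C. f c * x c)" for f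
    have "\<exists>t. (\<forall>l\<in>(\<lambda>g. s g / (- g k)) ` N. l < t) \<and> (\<forall>u\<in>(\<lambda>f. - s f / f k) ` P. t < u)"
    proof (rule real_between_finite_sets)
      fix l u assume "l \<in> (\<lambda>g. s g / (- g k)) ` N" "u \<in> (\<lambda>f. - s f / f k) ` P"
      then obtain f g where fg: "f \<in> P" "g \<in> N" "l = s g / (- g k)" "u = - s f / f k" by auto
      have "s (mix (f, g)) < 0" unfolding s_def by (rule x) (use fg in \<open>auto simp: G_def\<close>)
      also have "s (mix (f, g)) = f k * s g + (- g k) * s f"
        unfolding s_def mix_def by (simp add: algebra_simps sum.distrib sum_distrib_left sum_subtractf sum_negf)
      finally have "s g * f k < - s f * (- g k)" by (simp add: mult.commute)
      moreover have "f k > 0" "- g k > 0" using fg by (auto simp: P_def N_def)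
      ultimately show "l < u" unfolding fg(3,4) using pos_divide_less_eq pos_less_divide_eq
        by (metis mult.commute times_divide_eq_right)
    qed (use fin in auto)
    \<comment> \<open>The eliminated inequalities say exactly that this value of the variable \<open>k\<close> can be chosen.\<close>
    then obtain t where "\<forall>l\<in>(\<lambda>g. s g / (- g k)) ` N. l < t" "\<forall>u\<in>(\<lambda>f. - s f / f k) ` P. t < u"
      by (elim exE conjE)
    then have t: "\<And>g. g \<in> N \<Longrightarrow> s g / (- g k) < t" "\<And>f. f \<in> P \<Longrightarrow> t < - s f / f k"
      by (simp_all only: ball_simps)
    have neg: "s f + f k * t < 0" if "f \<in> F" for f
    proof -
      have "f \<in> P \<or> f \<in> N \<or> f \<in> Z" using that by (auto simp: P_def N_def Z_def)
      then consider "f \<in> P" | "f \<in> N" | "f \<in> Z" by blast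
      then show ?thesis
      proof cases
        case 1 then show ?thesis using t(2)[of f] by (simp add: P_def field_simps)
      next
        case 2 then show ?thesis using t(1)[of f] by (simp add: N_def field_simps)
      next
        case 3 then show ?thesis using x[of f] by (simp add: s_def Z_def G_def)
      qed
    qed
    have eq: "(\<Sum>c\<in>insert k C. f c * (x(k := t)) c) = s f + f k * t" for f
    proof -
      have "(\<Sum>c\<in>C. f c * (x(k := t)) c) = s f" unfolding s_def
        using insert.hyps by (intro sum.cong) auto
      then show ?thesis using insert.hyps by simp
    qed
    have "\<forall>f\<in>F. (\<Sum>c\<in>insert k C. f c * (x(k := t)) c) < 0"
      unfolding eq using neg by blast
    then show ?thesis by blast
  next
    assume "\<exists>h\<in>pos_comb G. \<forall>c\<in>C. h c = 0"
    then show ?thesis using pos_comb_subset[OF _ G_F] G_k by (metis insert_iff)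
  qed
qed

text \<open>If every feasible solution of the covering program has value above \<open>b\<close> (in particular if there
is none), the packing program has a solution above \<open>b\<close>, and even one with all variables positive. The strict
inequality in the hypothesis avoids any discussion of attained optima.\<close>

lemma lp_duality:
  fixes a :: "'r \<Rightarrow> 'c \<Rightarrow> real"
  assumes fin: "finite R" "finite C"
    and primal: "\<And>\<alpha>. \<lbrakk>\<And>r. r \<in> R \<Longrightarrow> \<alpha> r \<ge> 0; \<And>c. c \<in> C \<Longrightarrow> (\<Sum>r\<in>R. \<alpha> r * a r c) \<ge> 1\<rbrakk>
      \<Longrightarrow> b < (\<Sum>r\<in>R. \<alpha> r)"
  obtains x where "\<And>c. c \<in> C \<Longrightarrow> x c > 0" "\<And>r. r \<in> R \<Longrightarrow> (\<Sum>c\<in>C. a r c * x c) \<le> 1"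
    "b < (\<Sum>c\<in>C. x c)"
proof -
  \<comment> \<open>Homogenised system, with \<open>None\<close> the homogenising variable: \<open>row r\<close> encodes the constraint
of \<open>r\<close>, \<open>unit j\<close> the positivity of the variable \<open>j\<close>, and \<open>top\<close> the bound on the objective.\<close>
  define row where "row r = (\<lambda>k. case k of None \<Rightarrow> -1 | Some c \<Rightarrow> a r c)" for r
  define unit where "unit j = (\<lambda>k. - of_bool (k = j) :: real)" for j :: "'c option"
  define top where "top = (\<lambda>k. case k of None \<Rightarrow> b | Some (c::'c) \<Rightarrow> -1)"
  define K where "K = insert None (Some ` C)"
  define F where "F = row ` R \<union> unit ` K \<union> {top}"
  have finK: "finite K" and finF: "finite F" using fin by (auto simp: K_def F_def)
  have sumK: "(\<Sum>k\<in>K. h k) = h None + (\<Sum>c\<in>C. h (Some c))" for h :: "'c option \<Rightarrow> real"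
    unfolding K_def using fin by (simp add: sum.reindex image_iff)
  \<comment> \<open>The Gordan certificate in coordinates: multipliers of the rows, of the units and of \<open>top\<close>.\<close>
  have comb: "\<exists>\<beta> \<gamma> \<epsilon>. (\<forall>r. \<beta> r \<ge> 0) \<and> (\<forall>k. \<gamma> k \<ge> 0) \<and> \<epsilon> \<ge> 0 \<and>
      (\<Sum>r\<in>R. \<beta> r) + (\<Sum>k\<in>K. \<gamma> k) + \<epsilon> > 0 \<and>
      (\<forall>k\<in>K. h k = (\<Sum>r\<in>R. \<beta> r * row r k) - \<gamma> k + \<epsilon> * top k)" if "h \<in> pos_comb F" for h
    using that
  proof induction
    case (gen f)
    then consider r where "r \<in> R" "f = row r" | j where "j \<in> K" "f = unit j" | "f = top"
      by (auto simp: F_def)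
    then show ?case
    proof cases
      case 1
      show ?thesis
        by (rule exI[of _ "\<lambda>q. of_bool (q = r)"], rule exI[of _ "\<lambda>_. 0"], rule exI[of _ 0])
          (use 1 fin in \<open>auto simp: of_bool_def if_distrib if_distribR sum.delta cong: if_cong\<close>)
    next
      case 2
      show ?thesis
        by (rule exI[of _ "\<lambda>_. 0"], rule exI[of _ "\<lambda>q. of_bool (q = j)"], rule exI[of _ 0])
          (use 2 finK in \<open>auto simp: unit_def of_bool_def sum.delta\<close>)
    next
      case 3
      show ?thesis
        by (rule exI[of _ "\<lambda>_. 0"], rule exI[of _ "\<lambda>_. 0"], rule exI[of _ 1]) (use 3 in auto)
    qed
  next
    case (add f g)
    from add.IH(1) obtain \<beta> \<gamma> \<epsilon> where
      h: "\<forall>r. \<beta> r \<ge> 0" "\<forall>k. \<gamma> k \<ge> 0" "\<epsilon> \<ge> 0" "(\<Sum>r\<in>R. \<beta> r) + (\<Sum>k\<in>K. \<gamma> k) + \<epsilon> > 0"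
        "\<forall>k\<in>K. f k = (\<Sum>r\<in>R. \<beta> r * row r k) - \<gamma> k + \<epsilon> * top k" by blast
    from add.IH(2) obtain \<beta>' \<gamma>' \<epsilon>' where
      h': "\<forall>r. \<beta>' r \<ge> 0" "\<forall>k. \<gamma>' k \<ge> 0" "\<epsilon>' \<ge> 0" "(\<Sum>r\<in>R. \<beta>' r) + (\<Sum>k\<in>K. \<gamma>' k) + \<epsilon>' > 0"
        "\<forall>k\<in>K. g k = (\<Sum>r\<in>R. \<beta>' r * row r k) - \<gamma>' k + \<epsilon>' * top k" by blast
    have "f k + g k = (\<Sum>r\<in>R. (\<beta> r + \<beta>' r) * row r k) - (\<gamma> k + \<gamma>' k) + (\<epsilon> + \<epsilon>') * top k"
      if "k \<in> K" for k
      using h(5)[rule_format, OF that] h'(5)[rule_format, OF that]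
      by (simp add: sum.distrib distrib_right)
    then show ?case
      using h(1-4) h'(1-4)
      by (intro exI[of _ "\<lambda>r. \<beta> r + \<beta>' r"] exI[of _ "\<lambda>k. \<gamma> k + \<gamma>' k"] exI[of _ "\<epsilon> + \<epsilon>'"])
        (simp add: sum.distrib)
  next
    case (scale f t)
    from scale.IH obtain \<beta> \<gamma> \<epsilon> where
      h: "\<forall>r. \<beta> r \<ge> 0" "\<forall>k. \<gamma> k \<ge> 0" "\<epsilon> \<ge> 0" "(\<Sum>r\<in>R. \<beta> r) + (\<Sum>k\<in>K. \<gamma> k) + \<epsilon> > 0"
        "\<forall>k\<in>K. f k = (\<Sum>r\<in>R. \<beta> r * row r k) - \<gamma> k + \<epsilon> * top k" by blast
    have "(\<Sum>r\<in>R. t * \<beta> r) + (\<Sum>k\<in>K. t * \<gamma> k) + t * \<epsilon> = t * ((\<Sum>r\<in>R. \<beta> r) + (\<Sum>k\<in>K. \<gamma> k) + \<epsilon>)"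
      by (simp add: sum_distrib_left algebra_simps)
    also have "\<dots> > 0" using h(4) scale.hyps(2) by simp
    finally have pos: "(\<Sum>r\<in>R. t * \<beta> r) + (\<Sum>k\<in>K. t * \<gamma> k) + t * \<epsilon> > 0" .
    have "t * f k = (\<Sum>r\<in>R. (t * \<beta> r) * row r k) - t * \<gamma> k + (t * \<epsilon>) * top k" if "k \<in> K" for k
      using h(5)[rule_format, OF that] by (simp add: sum_distrib_left distrib_left right_diff_distrib mult.assoc)
    then show ?case
      using h(1-3) scale.hyps(2) pos
      by (intro exI[of _ "\<lambda>r. t * \<beta> r"] exI[of _ "\<lambda>k. t * \<gamma> k"] exI[of _ "t * \<epsilon>"]) simp
  qed
  have "\<not> (\<exists>h\<in>pos_comb F. \<forall>k\<in>K. h k = 0)"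
  proof
    assume "\<exists>h\<in>pos_comb F. \<forall>k\<in>K. h k = 0"
    then obtain h where "h \<in> pos_comb F" and h0: "\<forall>k\<in>K. h k = 0" by blast
    from comb[OF this(1)] h0 obtain \<beta> \<gamma> \<epsilon> where nonneg: "\<And>r. \<beta> r \<ge> 0" "\<And>k. \<gamma> k \<ge> 0" "\<epsilon> \<ge> 0"
      and pos: "(\<Sum>r\<in>R. \<beta> r) + (\<Sum>k\<in>K. \<gamma> k) + \<epsilon> > 0"
      and eq: "\<And>k. k \<in> K \<Longrightarrow> 0 = (\<Sum>r\<in>R. \<beta> r * row r k) - \<gamma> k + \<epsilon> * top k"
      by force
    have eqN: "(\<Sum>r\<in>R. \<beta> r) = \<epsilon> * b - \<gamma> None"
      using eq[of None] by (simp add: K_def row_def top_def sum_negf)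
    have eqS: "(\<Sum>r\<in>R. \<beta> r * a r c) = \<gamma> (Some c) + \<epsilon>" if "c \<in> C" for c
      using eq[of "Some c"] that by (simp add: K_def row_def top_def)
    show False
    proof (cases "\<epsilon> = 0")
      case True
      have "(\<Sum>r\<in>R. \<beta> r) \<ge> 0" using nonneg by (simp add: sum_nonneg)
      then have "(\<Sum>r\<in>R. \<beta> r) = 0" and gN: "\<gamma> None = 0" using eqN True nonneg(2)[of None] by auto
      then have "\<And>r. r \<in> R \<Longrightarrow> \<beta> r = 0" using fin nonneg by (simp add: sum_nonneg_eq_0_iff)
      then have "\<And>c. c \<in> C \<Longrightarrow> \<gamma> (Some c) = 0" using eqS True by force
      then show False using pos True gN \<open>(\<Sum>r\<in>R. \<beta> r) = 0\<close> by (simp add: sumK)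
    next
      case False
      then have e: "\<epsilon> > 0" using nonneg by simp
      \<comment> \<open>Normalised by the multiplier of \<open>top\<close>, the certificate becomes a covering solution of value at
most \<open>b\<close>.\<close>
      have "b < (\<Sum>r\<in>R. \<beta> r / \<epsilon>)"
      proof (rule primal)
        fix c assume c: "c \<in> C"
        have "(\<Sum>r\<in>R. \<beta> r / \<epsilon> * a r c) = (\<Sum>r\<in>R. \<beta> r * a r c) / \<epsilon>"
          by (simp add: sum_divide_distrib)
        also have "\<dots> \<ge> 1" using eqS[OF c] e nonneg(2)[of "Some c"] by (simp add: field_simps)
        finally show "1 \<le> (\<Sum>r\<in>R. \<beta> r / \<epsilon> * a r c)" .
      qed (use nonneg e in auto)
      also have "\<dots> = (\<epsilon> * b - \<gamma> None) / \<epsilon>" using eqN by (simp add: sum_divide_distrib[symmetric])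
      also have "\<dots> \<le> b" using e nonneg(2)[of None] by (simp add: field_simps)
      finally show False by simp
    qed
  qed
  then obtain x where x: "\<And>f. f \<in> F \<Longrightarrow> (\<Sum>k\<in>K. f k * x k) < 0"
    using gordan_alternative[OF finK finF] by blast
  have unit_x: "(\<Sum>k\<in>K. unit j k * x k) = - x j" if "j \<in> K" for j
    using that finK by (simp add: unit_def of_bool_def if_distrib if_distribR sum.delta sum_negf cong: if_cong)
  have pos: "x j > 0" if "j \<in> K" for j
    using x[of "unit j"] unit_x[OF that] that by (simp add: F_def)
  define t where "t = x None"
  have t: "t > 0" using pos by (simp add: K_def t_def)
  show ?thesis
  proof (rule that[of "\<lambda>c. x (Some c) / t"])
    show "x (Some c) / t > 0" if "c \<in> C" for c using pos[of "Some c"] t that by (simp add: K_def)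
    show "(\<Sum>c\<in>C. a r c * (x (Some c) / t)) \<le> 1" if "r \<in> R" for r
    proof -
      have "(\<Sum>c\<in>C. a r c * x (Some c)) < t"
        using x[of "row r"] that by (simp add: F_def sumK row_def t_def)
      then show ?thesis using t by (simp add: sum_divide_distrib[symmetric])
    qed
    have "b * t < (\<Sum>c\<in>C. x (Some c))"
      using x[of top] by (simp add: F_def sumK top_def t_def sum_negf)
    then show "b < (\<Sum>c\<in>C. x (Some c) / t)"
      using t by (simp add: sum_divide_distrib[symmetric] field_simps)
  qed
qed

section \<open>Orthogonal projection\<close>

text \<open>Least squares with positive weights \<open>w\<close>: some combination of the vectors \<open>b t\<close> differs from
\<open>z\<close> by a vector orthogonal to all of them. The induction is a Gram--Schmidt step; the
generators may be linearly dependent.\<close>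

lemma weighted_projection:
  fixes b :: "'t \<Rightarrow> 's \<Rightarrow> real"
  assumes "finite T" "finite S" and pos: "\<And>s. s \<in> S \<Longrightarrow> w s > 0"
  shows "\<exists>c. \<forall>t\<in>T. (\<Sum>s\<in>S. w s * (z s - (\<Sum>i\<in>T. c i * b i s)) * b t s) = 0"
  using assms(1)
proof (induction T arbitrary: z rule: finite_induct)
  case empty
  then show ?case by simp
next
  case (insert k T)
  obtain c where c: "\<And>t. t \<in> T \<Longrightarrow> (\<Sum>s\<in>S. w s * (z s - (\<Sum>i\<in>T. c i * b i s)) * b t s) = 0"
    using insert.IH by blast
  obtain d where d: "\<And>t. t \<in> T \<Longrightarrow> (\<Sum>s\<in>S. w s * (b k s - (\<Sum>i\<in>T. d i * b i s)) * b t s) = 0"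
    using insert.IH by blast
  define r where "r s = z s - (\<Sum>i\<in>T. c i * b i s)" for s
  define p where "p s = b k s - (\<Sum>i\<in>T. d i * b i s)" for s
  \<comment> \<open>\<open>r\<close> and \<open>p\<close> are the residuals of \<open>z\<close> and of the new vector \<open>b k\<close>. Since \<open>p\<close> is
orthogonal to the old vectors, the denominator is its squared norm; if that is \<open>0\<close>, then
\<open>b k\<close> is a combination of the old vectors and \<open>q = 0\<close>, the value of a division by \<open>0\<close>, is correct.\<close>
  define q where "q = (\<Sum>s\<in>S. w s * r s * b k s) / (\<Sum>s\<in>S. w s * p s * b k s)"
  define e where "e i = (if i = k then q else c i - q * d i)" for i
  have r_T: "(\<Sum>s\<in>S. w s * r s * b t s) = 0" and p_T: "(\<Sum>s\<in>S. w s * p s * b t s) = 0" if "t \<in> T" for t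
    using c d that by (auto simp: r_def p_def)
  have "(\<Sum>i\<in>T. e i * b i s) = (\<Sum>i\<in>T. c i * b i s) - q * (\<Sum>i\<in>T. d i * b i s)" for s
  proof -
    have "(\<Sum>i\<in>T. e i * b i s) = (\<Sum>i\<in>T. c i * b i s - q * (d i * b i s))"
      using insert.hyps by (intro sum.cong) (auto simp: e_def algebra_simps)
    then show ?thesis by (simp add: sum_subtractf sum_distrib_left)
  qed
  then have res: "z s - (\<Sum>i\<in>insert k T. e i * b i s) = r s - q * p s" for s
    using insert.hyps by (simp add: r_def p_def e_def algebra_simps)
  have split: "(\<Sum>s\<in>S. w s * (r s - q * p s) * b t s)
      = (\<Sum>s\<in>S. w s * r s * b t s) - q * (\<Sum>s\<in>S. w s * p s * b t s)" for t
    by (simp add: algebra_simps sum_subtractf sum_distrib_left)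
  have "(\<Sum>s\<in>S. w s * (r s - q * p s) * b k s) = 0"
  proof (cases "(\<Sum>s\<in>S. w s * p s * b k s) = 0")
    case True
    have "(\<Sum>s\<in>S. w s * (p s)\<^sup>2) = (\<Sum>s\<in>S. w s * p s * b k s - (\<Sum>i\<in>T. d i * (w s * p s * b i s)))"
    proof (rule sum.cong)
      fix s
      have "w s * (p s)\<^sup>2 = w s * p s * b k s - w s * p s * (\<Sum>i\<in>T. d i * b i s)"
        unfolding power2_eq_square by (subst (2) p_def) (simp add: algebra_simps)
      then show "w s * (p s)\<^sup>2 = w s * p s * b k s - (\<Sum>i\<in>T. d i * (w s * p s * b i s))"
        by (simp add: sum_distrib_left algebra_simps)
    qed simp
    also have "\<dots> = (\<Sum>s\<in>S. w s * p s * b k s) - (\<Sum>i\<in>T. d i * (\<Sum>s\<in>S. w s * p s * b i s))"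
    proof -
      have "(\<Sum>s\<in>S. \<Sum>i\<in>T. d i * (w s * p s * b i s)) = (\<Sum>i\<in>T. d i * (\<Sum>s\<in>S. w s * p s * b i s))"
        by (subst sum.swap) (simp add: sum_distrib_left)
      then show ?thesis by (simp add: sum_subtractf)
    qed
    also have "\<dots> = 0" using True p_T by simp
    finally have "\<forall>s\<in>S. w s * (p s)\<^sup>2 = 0"
      using pos assms(2) by (subst (asm) sum_nonneg_eq_0_iff) (auto simp: less_imp_le)
    then have p0: "p s = 0" if "s \<in> S" for s using pos[OF that] that by force
    have "(\<Sum>s\<in>S. w s * r s * b k s) = (\<Sum>s\<in>S. \<Sum>i\<in>T. d i * (w s * r s * b i s))"
    proof (rule sum.cong)
      fix s assume "s \<in> S"
      then have "b k s = (\<Sum>i\<in>T. d i * b i s)" using p0 by (simp add: p_def)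
      then show "w s * r s * b k s = (\<Sum>i\<in>T. d i * (w s * r s * b i s))"
        by (simp add: sum_distrib_left algebra_simps)
    qed simp
    also have "\<dots> = (\<Sum>i\<in>T. d i * (\<Sum>s\<in>S. w s * r s * b i s))"
      by (subst sum.swap) (simp add: sum_distrib_left)
    also have "\<dots> = 0" using r_T by simp
    finally show ?thesis unfolding split using True by simp
  next
    case False
    then show ?thesis unfolding split by (simp add: q_def)
  qed
  moreover have "(\<Sum>s\<in>S. w s * (r s - q * p s) * b t s) = 0" if "t \<in> T" for t
    unfolding split using r_T[OF that] p_T[OF that] by simp
  ultimately show ?case by (intro exI[of _ e]) (simp only: res, blast)
qed

section \<open>Chains, boundaries and coboundaries\<close>

text \<open>Simplices are oriented by an injective labelling \<open>f\<close> of the vertices. This is the incidence sign of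
the facet \<open>\<sigma>\<close> in \<open>insert v \<sigma>\<close>, so chains and cochains can be plain functions on sets.\<close>

definition insertion_sign :: "('a \<Rightarrow> nat) \<Rightarrow> 'a \<Rightarrow> 'a set \<Rightarrow> real" where
  "insertion_sign f v \<sigma> = (-1) ^ card {u\<in>\<sigma>. f u < f v}"

lemma insertion_sign_insert:
  assumes "finite \<sigma>" "u \<notin> \<sigma>"
  shows "insertion_sign f v (insert u \<sigma>) = (if f u < f v then - 1 else 1) * insertion_sign f v \<sigma>"
proof -
  have "{w \<in> insert u \<sigma>. f w < f v} = (if f u < f v then insert u {w\<in>\<sigma>. f w < f v} else {w\<in>\<sigma>. f w < f v})"
    by auto
  then show ?thesis using assms by (simp add: insertion_sign_def)
qed

lemma insertion_sign_sq [simp]: "insertion_sign f v \<sigma> * insertion_sign f v \<sigma> = 1"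
  unfolding insertion_sign_def by (simp flip: power_add)

lemma insertion_sign_anticommute:
  assumes "finite \<sigma>" "u \<notin> \<sigma>" "v \<notin> \<sigma>" "f u \<noteq> f v"
  shows "insertion_sign f u \<sigma> * insertion_sign f v (insert u \<sigma>)
       = - (insertion_sign f v \<sigma> * insertion_sign f u (insert v \<sigma>))"
  using assms by (auto simp: insertion_sign_insert)

text \<open>The form of anticommutation in which both faces of codimension one appear: it turns the
off-diagonal terms of the coboundary norm into products of terms of the adjoint.\<close>

lemma insertion_sign_exchange:
  assumes "finite \<sigma>" "u \<notin> \<sigma>" "v \<notin> \<sigma>" "f u \<noteq> f v"
  shows "insertion_sign f u (insert v \<sigma>) * insertion_sign f v (insert u \<sigma>)
       = - (insertion_sign f u \<sigma> * insertion_sign f v \<sigma>)"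
  using assms by (auto simp: insertion_sign_insert)

lemma sum_antisymmetric_pairs:
  fixes F :: "'b \<Rightarrow> 'b \<Rightarrow> real"
  assumes "finite A" and anti: "\<And>u v. u \<in> A \<Longrightarrow> v \<in> A \<Longrightarrow> u \<noteq> v \<Longrightarrow> F u v = - F v u"
  shows "(\<Sum>u\<in>A. \<Sum>v\<in>A - {u}. F u v) = 0"
proof -
  define G where "G u v = (if u = v then 0 else F u v)" for u v
  have eq: "(\<Sum>u\<in>A. \<Sum>v\<in>A - {u}. F u v) = (\<Sum>u\<in>A. \<Sum>v\<in>A. G u v)"
  proof (rule sum.cong)
    fix u assume "u \<in> A"
    show "(\<Sum>v\<in>A - {u}. F u v) = (\<Sum>v\<in>A. G u v)"
      using assms(1) by (intro sum.mono_neutral_cong_left) (auto simp: G_def)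
  qed simp
  also have "\<dots> = (\<Sum>u\<in>A. \<Sum>v\<in>A. G v u)" by (rule sum.swap)
  also have "\<dots> = (\<Sum>u\<in>A. \<Sum>v\<in>A. - G u v)"
  proof (intro sum.cong refl)
    fix u v assume "u \<in> A" "v \<in> A"
    then show "G v u = - G u v" using anti[of v u] by (simp add: G_def)
  qed
  also have "\<dots> = - (\<Sum>u\<in>A. \<Sum>v\<in>A. G u v)" by (simp only: sum_negf)
  finally show ?thesis using eq by linarith
qed

text \<open>The boundary is written as a sum over the vertices that can be added to \<open>\<sigma>\<close>. For a chain that vanishes
outside a complex, sets \<open>insert v \<sigma>\<close> outside that complex contribute nothing, so only the
vertex set is a parameter. The empty set is a face of size \<open>0\<close>, which makes the theory reduced.\<close>

definition boundary :: "('a \<Rightarrow> nat) \<Rightarrow> 'a set \<Rightarrow> ('a set \<Rightarrow> real) \<Rightarrow> 'a set \<Rightarrow> real" where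
  "boundary f V c \<sigma> = (\<Sum>v\<in>V - \<sigma>. insertion_sign f v \<sigma> * c (insert v \<sigma>))"

definition coboundary :: "('a \<Rightarrow> nat) \<Rightarrow> ('a set \<Rightarrow> real) \<Rightarrow> 'a set \<Rightarrow> real" where
  "coboundary f \<phi> \<tau> = (\<Sum>v\<in>\<tau>. insertion_sign f v (\<tau> - {v}) * \<phi> (\<tau> - {v}))"

text \<open>Faces are graded by cardinality, one more than the dimension, so that the empty face is in degree
\<open>0\<close>.\<close>

definition faces :: "'a set set \<Rightarrow> nat \<Rightarrow> 'a set set" where
  "faces X n = {\<sigma>\<in>X. card \<sigma> = n}"

definition chain :: "'a set set \<Rightarrow> nat \<Rightarrow> ('a set \<Rightarrow> real) \<Rightarrow> bool" where
  "chain X n c \<longleftrightarrow> (\<forall>\<sigma>. c \<sigma> \<noteq> 0 \<longrightarrow> \<sigma> \<in> faces X n)"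

lemma boundary_linear:
  "boundary f V (\<lambda>\<sigma>. \<Sum>i\<in>I. a i * c i \<sigma>) \<sigma> = (\<Sum>i\<in>I. a i * boundary f V (c i) \<sigma>)"
  unfolding boundary_def by (simp add: sum_distrib_left algebra_simps) (rule sum.swap)

lemma boundary_diff:
  "boundary f V (\<lambda>\<sigma>. c \<sigma> - d \<sigma>) \<sigma> = boundary f V c \<sigma> - boundary f V d \<sigma>"
  unfolding boundary_def by (simp add: sum_subtractf algebra_simps)

lemma boundary_boundary:
  assumes "finite V" "inj_on f V" "\<sigma> \<subseteq> V"
  shows "boundary f V (boundary f V c) \<sigma> = 0"
proof -
  have "boundary f V (boundary f V c) \<sigma> = (\<Sum>v\<in>V - \<sigma>. \<Sum>u\<in>V - \<sigma> - {v}.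
      insertion_sign f v \<sigma> * insertion_sign f u (insert v \<sigma>) * c (insert u (insert v \<sigma>)))"
    unfolding boundary_def by (simp only: sum_distrib_left mult.assoc Diff_insert[of V _ \<sigma>])
  also have "\<dots> = 0"
  proof (rule sum_antisymmetric_pairs)
    fix u v assume uv: "u \<in> V - \<sigma>" "v \<in> V - \<sigma>" "u \<noteq> v"
    have "f u \<noteq> f v" using uv assms(2) by (auto dest: inj_onD)
    then show "insertion_sign f u \<sigma> * insertion_sign f v (insert u \<sigma>) * c (insert v (insert u \<sigma>))
      = - (insertion_sign f v \<sigma> * insertion_sign f u (insert v \<sigma>) * c (insert u (insert v \<sigma>)))"
      using insertion_sign_anticommute[of \<sigma> u v f] uv assms(1,3)
      by (simp add: insert_commute finite_subset)
  qed (use assms in auto)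
  finally show ?thesis .
qed

text \<open>Double counting of incident pairs of a face and a facet. Adjointness and all rearrangements in the
energy identity are instances.\<close>

lemma sum_faces_delete_vertex:
  fixes F :: "'a \<Rightarrow> 'a set \<Rightarrow> real"
  assumes "finite_complex V X"
  shows "(\<Sum>\<tau>\<in>faces X (Suc n). \<Sum>v\<in>\<tau>. F v (\<tau> - {v}))
       = (\<Sum>\<sigma>\<in>faces X n. \<Sum>v\<in>{v\<in>V - \<sigma>. insert v \<sigma> \<in> X}. F v \<sigma>)"
proof -
  have X: "finite V" "X \<subseteq> Pow V" "\<And>\<sigma> \<tau>. \<sigma> \<in> X \<Longrightarrow> \<tau> \<subseteq> \<sigma> \<Longrightarrow> \<tau> \<in> X"
    using assms by (auto simp: finite_complex_def)
  have "finite X" using X(1,2) by (simp add: finite_subset)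
  then have fin: "finite (faces X k)" "\<And>\<sigma>. \<sigma> \<in> X \<Longrightarrow> finite \<sigma>" for k
    using X(1,2) by (auto simp: faces_def intro: finite_subset[of _ V])
  have "(\<Sum>\<tau>\<in>faces X (Suc n). \<Sum>v\<in>\<tau>. F v (\<tau> - {v}))
      = (\<Sum>(\<tau>, v)\<in>(SIGMA \<tau>:faces X (Suc n). \<tau>). F v (\<tau> - {v}))"
    using fin by (intro sum.Sigma) (auto simp: faces_def)
  also have "\<dots> = (\<Sum>(\<sigma>, v)\<in>(SIGMA \<sigma>:faces X n. {v\<in>V - \<sigma>. insert v \<sigma> \<in> X}). F v \<sigma>)"
  proof (rule sum.reindex_bij_witness[of _ "\<lambda>(\<sigma>, v). (insert v \<sigma>, v)" "\<lambda>(\<tau>, v). (\<tau> - {v}, v)"])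
    fix p assume "p \<in> (SIGMA \<tau>:faces X (Suc n). \<tau>)"
    then obtain \<tau> v where p: "p = (\<tau>, v)" "\<tau> \<in> X" "card \<tau> = Suc n" "v \<in> \<tau>"
      by (auto simp: faces_def)
    have "\<tau> - {v} \<in> X" "card (\<tau> - {v}) = n" "v \<in> V"
      using X(3)[OF p(2), of "\<tau> - {v}"] X(2) p by auto
    with p show "(case case p of (\<tau>, v) \<Rightarrow> (\<tau> - {v}, v) of (\<sigma>, v) \<Rightarrow> (insert v \<sigma>, v)) = p"
      "(case p of (\<tau>, v) \<Rightarrow> (\<tau> - {v}, v)) \<in> (SIGMA \<sigma>:faces X n. {v\<in>V - \<sigma>. insert v \<sigma> \<in> X})"
      "(case case p of (\<tau>, v) \<Rightarrow> (\<tau> - {v}, v) of (\<sigma>, v) \<Rightarrow> F v \<sigma>) = (case p of (\<tau>, v) \<Rightarrow> F v (\<tau> - {v}))"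
      by (auto simp: faces_def insert_absorb)
  next
    fix p assume "p \<in> (SIGMA \<sigma>:faces X n. {v\<in>V - \<sigma>. insert v \<sigma> \<in> X})"
    then obtain \<sigma> v where p: "p = (\<sigma>, v)" "\<sigma> \<in> X" "card \<sigma> = n" "v \<notin> \<sigma>" "insert v \<sigma> \<in> X"
      by (auto simp: faces_def)
    with fin(2)[OF p(2)] show "(case case p of (\<sigma>, v) \<Rightarrow> (insert v \<sigma>, v) of (\<tau>, v) \<Rightarrow> (\<tau> - {v}, v)) = p"
      "(case p of (\<sigma>, v) \<Rightarrow> (insert v \<sigma>, v)) \<in> (SIGMA \<tau>:faces X (Suc n). \<tau>)"
      by (auto simp: faces_def)
  qed
  also have "\<dots> = (\<Sum>\<sigma>\<in>faces X n. \<Sum>v\<in>{v\<in>V - \<sigma>. insert v \<sigma> \<in> X}. F v \<sigma>)"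
    using fin X(1) by (intro sum.Sigma[symmetric]) auto
  finally show ?thesis .
qed

lemma boundary_coboundary_adjoint:
  assumes X: "finite_complex V X" and c: "chain X (Suc n) c"
  shows "(\<Sum>\<sigma>\<in>faces X n. boundary f V c \<sigma> * \<phi> \<sigma>) = (\<Sum>\<tau>\<in>faces X (Suc n). c \<tau> * coboundary f \<phi> \<tau>)"
proof -
  define F where "F v \<sigma> = insertion_sign f v \<sigma> * c (insert v \<sigma>) * \<phi> \<sigma>" for v \<sigma>
  have "boundary f V c \<sigma> * \<phi> \<sigma> = (\<Sum>v\<in>{v\<in>V - \<sigma>. insert v \<sigma> \<in> X}. F v \<sigma>)" for \<sigma>
    unfolding boundary_def sum_distrib_right F_def
    using X c by (intro sum.mono_neutral_right) (auto simp: finite_complex_def chain_def faces_def)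
  then have "(\<Sum>\<sigma>\<in>faces X n. boundary f V c \<sigma> * \<phi> \<sigma>) = (\<Sum>\<tau>\<in>faces X (Suc n). \<Sum>v\<in>\<tau>. F v (\<tau> - {v}))"
    by (simp add: sum_faces_delete_vertex[OF X])
  also have "\<dots> = (\<Sum>\<tau>\<in>faces X (Suc n). c \<tau> * coboundary f \<phi> \<tau>)"
    unfolding coboundary_def sum_distrib_left F_def
    by (intro sum.cong refl) (auto simp: insert_absorb)
  finally show ?thesis .
qed

lemma boundary_cong_support:
  assumes "finite V" "W \<subseteq> V" "\<And>\<sigma>. c \<sigma> \<noteq> 0 \<Longrightarrow> \<sigma> \<subseteq> W"
  shows "boundary f W c \<sigma> = boundary f V c \<sigma>"
  unfolding boundary_def using assms by (intro sum.mono_neutral_left) auto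

lemma chain_boundary:
  assumes X: "finite_complex V X" and c: "chain X (Suc n) c" and "boundary f V c \<sigma> \<noteq> 0"
  shows "\<sigma> \<in> faces X n"
proof -
  obtain v where v: "v \<in> V - \<sigma>" "c (insert v \<sigma>) \<noteq> 0"
    using assms(3) unfolding boundary_def by (metis (no_types, lifting) mult_zero_right sum.neutral)
  then have *: "insert v \<sigma> \<in> X" "card (insert v \<sigma>) = Suc n" using c by (auto simp: chain_def faces_def)
  then have "finite (insert v \<sigma>)" by (intro card_ge_0_finite) simp
  then show ?thesis using v * X unfolding faces_def finite_complex_def by auto
qed

section \<open>Missing faces and blocked pairs\<close>

lemma missing_face_below:
  assumes "finite V" "\<tau> \<subseteq> V" "\<tau> \<notin> X"
  obtains F where "F \<subseteq> \<tau>" "missing_face V X F"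
proof -
  obtain F where F: "F \<subseteq> \<tau>" "F \<notin> X" and least: "\<And>G. G \<subseteq> \<tau> \<and> G \<notin> X \<Longrightarrow> card F \<le> card G"
    using ex_has_least_nat[of "\<lambda>F. F \<subseteq> \<tau> \<and> F \<notin> X" \<tau> card] assms by blast
  have "finite F" using assms F finite_subset by metis
  then have "G \<in> X" if "G \<subset> F" for G
    using least[of G] psubset_card_mono[of F G] that F by force
  then have "missing_face V X F" using F assms by (auto simp: missing_face_def)
  with F that show ?thesis by blast
qed

text \<open>For \<open>v\<close> and \<open>u\<close> in the link of \<open>\<eta>\<close> this says that the two do not extend \<open>\<eta>\<close> jointly (\<open>blocked_iff\<close>). It is
defined through missing faces, and for arbitrary \<open>u\<close>, because row sums over all vertices are
needed below.\<close>

definition blocked :: "'a set \<Rightarrow> 'a set set \<Rightarrow> 'a set \<Rightarrow> 'a \<Rightarrow> 'a \<Rightarrow> bool" where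
  "blocked V X \<eta> v u \<longleftrightarrow> (\<exists>\<sigma>\<subseteq>\<eta>. {v, u} \<union> \<sigma> \<in> missing_faces V X (card \<sigma> + 1))"

lemma blocked_commute: "blocked V X \<eta> v u = blocked V X \<eta> u v"
  by (simp add: blocked_def insert_commute)

lemma blocked_irrefl: "finite \<eta> \<Longrightarrow> \<not> blocked V X \<eta> v v"
proof
  assume "finite \<eta>" "blocked V X \<eta> v v"
  then obtain \<sigma> where "finite \<sigma>" "card (insert v \<sigma>) = card \<sigma> + 2"
    by (auto simp: blocked_def missing_faces_def intro: finite_subset)
  then show False using card_insert_le_m1[of "card \<sigma> + 1" \<sigma> v] by (simp add: card_insert_if split: if_splits)
qed

lemma missing_face_blocks:
  assumes "missing_face V X F" "finite V" "v \<in> F" "u \<in> F" "v \<noteq> u" "F - {v, u} \<subseteq> \<eta>"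
  shows "blocked V X \<eta> v u"
proof -
  have "finite F" using assms by (auto simp: missing_face_def intro: finite_subset)
  moreover have "{v, u} \<subseteq> F" using assms by simp
  ultimately have "card (F - {v, u}) = card F - card {v, u}" "card {v, u} \<le> card F"
    by (simp_all only: card_Diff_subset card_mono finite_subset[of _ F])
  then have "card F = card (F - {v, u}) + 2" using assms by simp
  moreover have "{v, u} \<union> (F - {v, u}) = F" using assms by blast
  ultimately show ?thesis unfolding blocked_def missing_faces_def
    using assms by (intro exI[of _ "F - {v, u}"]) simp
qed

lemma blocked_iff:
  assumes X: "finite_complex V X" and "insert v \<eta> \<in> X" "insert u \<eta> \<in> X" "v \<noteq> u"
  shows "blocked V X \<eta> v u \<longleftrightarrow> insert u (insert v \<eta>) \<notin> X"
proof
  assume "blocked V X \<eta> v u"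
  then obtain \<sigma> where \<sigma>: "\<sigma> \<subseteq> \<eta>" "missing_face V X ({v, u} \<union> \<sigma>)"
    by (auto simp: blocked_def missing_faces_def)
  then have "{v, u} \<union> \<sigma> \<notin> X" "{v, u} \<union> \<sigma> \<subseteq> insert u (insert v \<eta>)" by (auto simp: missing_face_def)
  then show "insert u (insert v \<eta>) \<notin> X" using X unfolding finite_complex_def by metis
next
  assume "insert u (insert v \<eta>) \<notin> X"
  moreover have "insert u (insert v \<eta>) \<subseteq> V" "finite V" using assms by (auto simp: finite_complex_def)
  ultimately obtain F where F: "F \<subseteq> insert u (insert v \<eta>)" "missing_face V X F"
    using missing_face_below by metis
  have "F \<notin> X" using F by (simp add: missing_face_def)
  then have "\<not> F \<subseteq> insert v \<eta>" "\<not> F \<subseteq> insert u \<eta>" using assms unfolding finite_complex_def by metis+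
  then have "v \<in> F" "u \<in> F" using F by auto
  then show "blocked V X \<eta> v u"
    using F \<open>finite V\<close> assms(4) by (intro missing_face_blocks[of V X F]) auto
qed

text \<open>A missing face inside \<open>insert u \<sigma>\<close> contains \<open>u\<close>, and some \<open>v \<in> \<sigma>\<close> besides, as singletons are faces.\<close>

lemma non_extending_vertex_blocked:
  assumes X: "finite_complex V X" and "\<sigma> \<in> X" "u \<in> V" "insert u \<sigma> \<notin> X"
  obtains v where "v \<in> \<sigma>" "blocked V X (\<sigma> - {v}) v u"
proof -
  have "insert u \<sigma> \<subseteq> V" "finite V" using assms by (auto simp: finite_complex_def)
  then obtain F where F: "F \<subseteq> insert u \<sigma>" "missing_face V X F"
    using missing_face_below assms(4) by metis
  have "F \<notin> X" using F by (simp add: missing_face_def)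
  then have "\<not> F \<subseteq> \<sigma>" "\<not> F \<subseteq> {u}" using assms unfolding finite_complex_def by metis+
  then obtain v where "u \<in> F" "v \<in> F" "v \<noteq> u" using F by auto
  moreover have "u \<notin> \<sigma>" using assms by (metis insert_absorb)
  ultimately show ?thesis using F \<open>finite V\<close>
    by (intro that[of v] missing_face_blocks[of V X F]) auto
qed

lemma missing_dims_pos:
  assumes "finite_complex V X" "r \<in> missing_dims V X"
  shows "r > 0"
proof (rule ccontr)
  assume "\<not> r > 0"
  then obtain F where "missing_face V X F" "card F = 1"
    using assms(2) by (auto simp: missing_dims_def missing_faces_def)
  then show False using assms(1) by (auto simp: missing_face_def finite_complex_def card_1_singleton_iff)
qed

lemma finite_missing_dims:
  assumes "finite_complex V X"
  shows "finite (missing_dims V X)"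
proof (rule finite_subset)
  show "missing_dims V X \<subseteq> {..card V}"
  proof
    fix r assume "r \<in> missing_dims V X"
    then obtain F where "F \<subseteq> V" "card F = r + 1"
      by (auto simp: missing_dims_def missing_faces_def missing_face_def)
    moreover have "finite V" using assms by (simp add: finite_complex_def)
    ultimately show "r \<in> {..card V}" using card_mono[of V F] by simp
  qed
qed simp

lemma card_rep_index_below:
  assumes X: "finite_complex V X" and "\<eta> \<subseteq> V"
  shows "card {\<sigma>\<in>rep_index V X. \<sigma> \<subseteq> \<eta>} = (\<Sum>r\<in>missing_dims V X. card \<eta> choose (r - 1))"
proof -
  have fin: "finite \<eta>" using assms by (auto simp: finite_complex_def intro: finite_subset)
  have "{\<sigma>\<in>rep_index V X. \<sigma> \<subseteq> \<eta>} = (\<Union>r\<in>missing_dims V X. {\<sigma>. \<sigma> \<subseteq> \<eta> \<and> card \<sigma> = r - 1})"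
    using assms(2) by (auto simp: rep_index_def)
  also have "card \<dots> = (\<Sum>r\<in>missing_dims V X. card {\<sigma>. \<sigma> \<subseteq> \<eta> \<and> card \<sigma> = r - 1})"
  proof (rule card_UN_disjoint)
    show "\<forall>i\<in>missing_dims V X. \<forall>j\<in>missing_dims V X. i \<noteq> j \<longrightarrow>
        {\<sigma>. \<sigma> \<subseteq> \<eta> \<and> card \<sigma> = i - 1} \<inter> {\<sigma>. \<sigma> \<subseteq> \<eta> \<and> card \<sigma> = j - 1} = {}"
    proof (intro ballI impI)
      fix i j assume ij: "i \<in> missing_dims V X" "j \<in> missing_dims V X" "i \<noteq> j"
      then have "i - 1 \<noteq> j - 1" using missing_dims_pos[OF X ij(1)] missing_dims_pos[OF X ij(2)] by linarith
      then show "{\<sigma>. \<sigma> \<subseteq> \<eta> \<and> card \<sigma> = i - 1} \<inter> {\<sigma>. \<sigma> \<subseteq> \<eta> \<and> card \<sigma> = j - 1} = {}" by auto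
    qed
  qed (use fin finite_missing_dims[OF X] in auto)
  also have "\<dots> = (\<Sum>r\<in>missing_dims V X. card \<eta> choose (r - 1))"
    using fin by (simp add: n_subsets)
  finally show ?thesis .
qed

text \<open>Each face of size \<open>n + 1\<close> has \<open>n + 1\<close> facets, and each of them loses one unit for every index set below it;
this rewrites the total loss in the form of the bound of the theorem.\<close>

lemma sum_binomial_absorb:
  assumes X: "finite_complex V X"
  shows "Suc n * (\<Sum>r\<in>missing_dims V X. n choose (r - 1)) = (\<Sum>r\<in>missing_dims V X. r * (Suc n choose r))"
  unfolding sum_distrib_left
proof (rule sum.cong)
  fix r assume "r \<in> missing_dims V X"
  then obtain k where r: "r = Suc k" using missing_dims_pos[OF X] gr0_implies_Suc by blast
  have "Suc n * (n choose k) = Suc k * (Suc n choose Suc k)"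
    using Suc_times_binomial_eq[of n k] by (simp only: mult.commute)
  then show "Suc n * (n choose (r - 1)) = r * (Suc n choose r)"
    unfolding r by (simp only: diff_Suc_1)
qed simp

section \<open>Vanishing of harmonic cochains\<close>

text \<open>\<open>B \<sigma>\<close> stands for the Gram matrix of a vector representation at \<open>\<sigma>\<close>, and \<open>x\<close> for a feasible
solution of the dual program.\<close>

locale weighted_complex =
  fixes V :: "'a set" and X :: "'a set set" and f :: "'a \<Rightarrow> nat"
    and B :: "'a set \<Rightarrow> 'a \<Rightarrow> 'a \<Rightarrow> real" and x :: "'a \<Rightarrow> real"
  assumes X: "finite_complex V X" and inj: "inj_on f V"
    and x_pos: "\<And>v. v \<in> V \<Longrightarrow> x v > 0"
    and B_sym: "\<And>\<sigma> v u. \<lbrakk>\<sigma> \<in> rep_index V X; v \<in> V; u \<in> V\<rbrakk> \<Longrightarrow> B \<sigma> v u = B \<sigma> u v"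
    and B_nonneg: "\<And>\<sigma> v u. \<lbrakk>\<sigma> \<in> rep_index V X; v \<in> V; u \<in> V\<rbrakk> \<Longrightarrow> B \<sigma> v u \<ge> 0"
    and B_missing: "\<And>\<sigma> v u. \<lbrakk>\<sigma> \<in> rep_index V X; v \<in> V; u \<in> V;
          {v, u} \<union> \<sigma> \<in> missing_faces V X (card \<sigma> + 1)\<rbrakk> \<Longrightarrow> B \<sigma> v u \<ge> 1"
    and B_psd: "\<And>\<sigma> L y. \<lbrakk>\<sigma> \<in> rep_index V X; L \<subseteq> V\<rbrakk> \<Longrightarrow> (\<Sum>v\<in>L. \<Sum>u\<in>L. B \<sigma> v u * (y v * y u)) \<ge> 0"
    and B_x: "\<And>\<sigma> v. \<lbrakk>\<sigma> \<in> rep_index V X; v \<in> V\<rbrakk> \<Longrightarrow> (\<Sum>u\<in>V. B \<sigma> v u * x u) \<le> 1"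
begin

lemma fin_V: "finite V" and X_sub: "\<And>\<sigma>. \<sigma> \<in> X \<Longrightarrow> \<sigma> \<subseteq> V"
  and X_down: "\<And>\<sigma> \<tau>. \<sigma> \<in> X \<Longrightarrow> \<tau> \<subseteq> \<sigma> \<Longrightarrow> \<tau> \<in> X"
proof -
  note * = X[unfolded finite_complex_def, THEN conjunct1]
    X[unfolded finite_complex_def, THEN conjunct2, THEN conjunct1]
    X[unfolded finite_complex_def, THEN conjunct2, THEN conjunct2, THEN conjunct2, THEN conjunct2]
  from *(1) show "finite V" .
  from *(2) show "\<sigma> \<subseteq> V" if "\<sigma> \<in> X" for \<sigma> using that by (rule_tac PowD, rule_tac subsetD)
  from *(3) show "\<tau> \<in> X" if "\<sigma> \<in> X" "\<tau> \<subseteq> \<sigma>" for \<sigma> \<tau> using that by simp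
qed

lemma fin_face: "\<sigma> \<in> X \<Longrightarrow> finite \<sigma>"
  using X_sub fin_V finite_subset by metis

lemma fin_faces: "finite (faces X n)"
  by (rule finite_subset[of _ "Pow V"]) (auto simp: faces_def fin_V dest: X_sub)

lemma fin_rep: "finite {\<sigma>\<in>rep_index V X. \<sigma> \<subseteq> \<eta>}"
  by (rule finite_subset[of _ "Pow V"]) (auto simp: rep_index_def fin_V)

text \<open>How far the sum of the matrices \<open>B \<sigma>\<close> over \<open>\<sigma> \<subseteq> \<eta>\<close> exceeds the indicator of blocked pairs. It
is a nonnegative symmetric matrix, so its quadratic form is bounded by its weighted row
sums.\<close>

definition excess :: "'a set \<Rightarrow> 'a \<Rightarrow> 'a \<Rightarrow> real" where
  "excess \<eta> v u = (\<Sum>\<sigma>\<in>{\<sigma>\<in>rep_index V X. \<sigma> \<subseteq> \<eta>}. B \<sigma> v u) - of_bool (blocked V X \<eta> v u)"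

lemma excess_nonneg:
  assumes "v \<in> V" "u \<in> V" "\<eta> \<subseteq> V"
  shows "excess \<eta> v u \<ge> 0"
proof (cases "blocked V X \<eta> v u")
  case True
  then obtain \<sigma> where \<sigma>: "\<sigma> \<subseteq> \<eta>" "{v, u} \<union> \<sigma> \<in> missing_faces V X (card \<sigma> + 1)"
    by (auto simp: blocked_def)
  then have "card \<sigma> + 1 \<in> missing_dims V X" by (auto simp: missing_dims_def)
  then have \<sigma>_rep: "\<sigma> \<in> rep_index V X" using \<sigma> assms by (force simp: rep_index_def)
  have "1 \<le> B \<sigma> v u" using B_missing \<sigma> \<sigma>_rep assms by blast
  also have "\<dots> \<le> (\<Sum>\<sigma>\<in>{\<sigma>\<in>rep_index V X. \<sigma> \<subseteq> \<eta>}. B \<sigma> v u)"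
    using \<sigma> \<sigma>_rep assms B_nonneg fin_rep by (intro member_le_sum) auto
  finally show ?thesis using True by (simp add: excess_def)
next
  case False
  then show ?thesis using assms B_nonneg by (auto simp: excess_def intro!: sum_nonneg)
qed

lemma excess_sym: "v \<in> V \<Longrightarrow> u \<in> V \<Longrightarrow> excess \<eta> v u = excess \<eta> u v"
  unfolding excess_def by (intro arg_cong2[of _ _ _ _ "(-)"] sum.cong) (auto simp: B_sym[of _ v u] blocked_commute[of V X \<eta> v u])

lemma sum_excess_le:
  assumes "v \<in> V"
  shows "(\<Sum>u\<in>V. excess \<eta> v u * x u)
    \<le> real (card {\<sigma>\<in>rep_index V X. \<sigma> \<subseteq> \<eta>}) - (\<Sum>u\<in>V. of_bool (blocked V X \<eta> v u) * x u)"
proof -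
  have "(\<Sum>u\<in>V. (\<Sum>\<sigma>\<in>{\<sigma>\<in>rep_index V X. \<sigma> \<subseteq> \<eta>}. B \<sigma> v u) * x u)
      = (\<Sum>\<sigma>\<in>{\<sigma>\<in>rep_index V X. \<sigma> \<subseteq> \<eta>}. \<Sum>u\<in>V. B \<sigma> v u * x u)"
    unfolding sum_distrib_right by (rule sum.swap)
  also have "\<dots> \<le> (\<Sum>\<sigma>\<in>{\<sigma>\<in>rep_index V X. \<sigma> \<subseteq> \<eta>}. 1)"
    using assms B_x by (intro sum_mono) auto
  finally show ?thesis by (simp add: excess_def left_diff_distrib sum_subtractf)
qed

text \<open>As the weighted sum of \<open>g\<close> over the link vanishes, the sum over jointly extending pairs is minus the diagonal
minus the sum over blocked pairs. The indicator of blocked pairs equals a positive semidefinite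
matrix minus \<open>excess \<eta>\<close>; the former is dropped and the latter is estimated by
\<open>2 * g v * g u \<le> (g v)\<^sup>2 + (g u)\<^sup>2\<close> and its row sums. The row sums
run over all vertices, not only over the link, which keeps the blocked vertices on the right-hand side;
they are used up in \<open>vertex_weights_covered\<close>.\<close>

lemma link_estimate:
  assumes \<eta>: "\<eta> \<in> X" and g: "\<And>v. v \<in> V - \<eta> \<Longrightarrow> insert v \<eta> \<notin> X \<Longrightarrow> g v = 0"
    and balanced: "(\<Sum>v\<in>V - \<eta>. x v * g v) = 0"
  shows "(\<Sum>v\<in>V - \<eta>. \<Sum>u\<in>V - \<eta>. if v \<noteq> u \<and> insert u (insert v \<eta>) \<in> X then (x v * g v) * (x u * g u) else 0)
    \<le> (\<Sum>v\<in>V - \<eta>. x v * (g v)\<^sup>2 * (real (card {\<sigma>\<in>rep_index V X. \<sigma> \<subseteq> \<eta>}) - x v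
          - (\<Sum>u\<in>V. of_bool (blocked V X \<eta> v u) * x u)))"
    (is "?lhs \<le> ?rhs")
proof -
  define L where "L = V - \<eta>"
  define y where "y v = x v * g v" for v
  define S where "S = {\<sigma>\<in>rep_index V X. \<sigma> \<subseteq> \<eta>}"
  define A where "A v u = (of_bool (blocked V X \<eta> v u) :: real)" for v u
  have L: "finite L" "L \<subseteq> V" using fin_V by (auto simp: L_def)
  have \<eta>V: "\<eta> \<subseteq> V" "finite \<eta>" using \<eta> X_sub fin_face by auto
  have "(if v \<noteq> u \<and> insert u (insert v \<eta>) \<in> X then y v * y u else 0)
      = y v * y u - (if u = v then y v * y v else 0) - A v u * (y v * y u)" if "v \<in> L" "u \<in> L" for v u
  proof (cases "insert v \<eta> \<in> X \<and> insert u \<eta> \<in> X")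
    case True
    then show ?thesis using blocked_iff[OF X, of v \<eta> u] blocked_irrefl[OF \<eta>V(2), of V X v]
      by (auto simp: A_def)
  next
    case False
    then have "y v * y u = 0" "u = v \<Longrightarrow> y v = 0" using g that by (auto simp: y_def L_def)
    then show ?thesis by auto
  qed
  then have "?lhs = (\<Sum>v\<in>L. \<Sum>u\<in>L. y v * y u - (if u = v then y v * y v else 0) - A v u * (y v * y u))"
    unfolding L_def[symmetric] y_def[symmetric] by (intro sum.cong) auto
  also have "\<dots> = (\<Sum>v\<in>L. y v) * (\<Sum>u\<in>L. y u) - (\<Sum>v\<in>L. y v * y v) - (\<Sum>v\<in>L. \<Sum>u\<in>L. A v u * (y v * y u))"
    using L by (simp add: sum_subtractf sum.delta sum_product)
  also have "(\<Sum>v\<in>L. y v) = 0" using balanced by (simp add: y_def L_def)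
  finally have lhs: "?lhs = - (\<Sum>v\<in>L. y v * y v) - (\<Sum>v\<in>L. \<Sum>u\<in>L. A v u * (y v * y u))" by simp
  have "(\<Sum>v\<in>L. \<Sum>u\<in>L. (\<Sum>\<sigma>\<in>S. B \<sigma> v u) * (y v * y u))
      = (\<Sum>v\<in>L. \<Sum>\<sigma>\<in>S. \<Sum>u\<in>L. B \<sigma> v u * (y v * y u))"
    unfolding sum_distrib_right by (intro sum.cong refl sum.swap)
  also have "\<dots> = (\<Sum>\<sigma>\<in>S. \<Sum>v\<in>L. \<Sum>u\<in>L. B \<sigma> v u * (y v * y u))" by (rule sum.swap)
  also have "\<dots> \<ge> 0" by (rule sum_nonneg) (simp add: S_def B_psd[OF _ L(2), of _ y])
  finally have psd: "(\<Sum>v\<in>L. \<Sum>u\<in>L. (\<Sum>\<sigma>\<in>S. B \<sigma> v u) * (y v * y u)) \<ge> 0" .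
  have "(\<Sum>v\<in>L. \<Sum>u\<in>L. A v u * (y v * y u))
      = (\<Sum>v\<in>L. \<Sum>u\<in>L. (\<Sum>\<sigma>\<in>S. B \<sigma> v u) * (y v * y u)) - (\<Sum>v\<in>L. \<Sum>u\<in>L. excess \<eta> v u * (y v * y u))"
    by (simp add: excess_def A_def S_def left_diff_distrib sum_subtractf)
  with psd lhs have lhs_le: "?lhs \<le> (\<Sum>v\<in>L. \<Sum>u\<in>L. excess \<eta> v u * (y v * y u)) - (\<Sum>v\<in>L. y v * y v)"
    by linarith
  define M where "M v u = excess \<eta> v u * (x v * x u)" for v u
  have M_sym: "M v u = M u v" if "v \<in> L" "u \<in> L" for v u
    using that L excess_sym[of v u] by (auto simp: M_def)
  have M_nonneg: "M v u \<ge> 0" if "v \<in> L" "u \<in> L" for v u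
  proof -
    have "v \<in> V" "u \<in> V" using that L by auto
    then show ?thesis using excess_nonneg[of v u \<eta>] x_pos[of v] x_pos[of u] \<eta>V by (simp add: M_def)
  qed
  have "(\<Sum>v\<in>L. \<Sum>u\<in>L. excess \<eta> v u * (y v * y u))
      \<le> (\<Sum>v\<in>L. \<Sum>u\<in>L. M v u * (g v)\<^sup>2 / 2 + M v u * (g u)\<^sup>2 / 2)"
  proof (intro sum_mono)
    fix v u assume "v \<in> L" "u \<in> L"
    have "g v * g u \<le> ((g v)\<^sup>2 + (g u)\<^sup>2) / 2" using sum_squares_bound[of "g v" "g u"] by simp
    then have "M v u * (g v * g u) \<le> M v u * (((g v)\<^sup>2 + (g u)\<^sup>2) / 2)"
      using M_nonneg[OF \<open>v \<in> L\<close> \<open>u \<in> L\<close>] by (rule mult_left_mono)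
    then show "excess \<eta> v u * (y v * y u) \<le> M v u * (g v)\<^sup>2 / 2 + M v u * (g u)\<^sup>2 / 2"
      by (simp add: M_def y_def algebra_simps add_divide_distrib)
  qed
  also have "\<dots> = (\<Sum>v\<in>L. \<Sum>u\<in>L. M v u * (g v)\<^sup>2 / 2) + (\<Sum>v\<in>L. \<Sum>u\<in>L. M v u * (g u)\<^sup>2 / 2)"
    by (simp add: sum.distrib)
  also have "(\<Sum>v\<in>L. \<Sum>u\<in>L. M v u * (g u)\<^sup>2 / 2) = (\<Sum>u\<in>L. \<Sum>v\<in>L. M v u * (g u)\<^sup>2 / 2)"
    by (rule sum.swap)
  also have "\<dots> = (\<Sum>v\<in>L. \<Sum>u\<in>L. M v u * (g v)\<^sup>2 / 2)"
    using M_sym by (intro sum.cong) auto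
  also have "(\<Sum>v\<in>L. \<Sum>u\<in>L. M v u * (g v)\<^sup>2 / 2) + \<dots> = (\<Sum>v\<in>L. x v * (g v)\<^sup>2 * (\<Sum>u\<in>L. excess \<eta> v u * x u))"
    by (simp add: sum.distrib[symmetric] sum_distrib_left M_def algebra_simps)
  also have "\<dots> \<le> (\<Sum>v\<in>L. x v * (g v)\<^sup>2 * (real (card S) - (\<Sum>u\<in>V. A v u * x u)))"
  proof (intro sum_mono mult_left_mono)
    fix v assume "v \<in> L"
    then have v: "v \<in> V" using L by auto
    have "(\<Sum>u\<in>L. excess \<eta> v u * x u) \<le> (\<Sum>u\<in>V. excess \<eta> v u * x u)"
      using L fin_V v \<eta>V excess_nonneg x_pos by (intro sum_mono2) (auto simp: less_imp_le)
    also have "\<dots> \<le> real (card S) - (\<Sum>u\<in>V. A v u * x u)"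
      using sum_excess_le[OF v] by (simp add: S_def A_def)
    finally show "(\<Sum>u\<in>L. excess \<eta> v u * x u) \<le> real (card S) - (\<Sum>u\<in>V. A v u * x u)" .
    show "0 \<le> x v * (g v)\<^sup>2" using x_pos[OF v] by simp
  qed
  finally have "?lhs \<le> (\<Sum>v\<in>L. x v * (g v)\<^sup>2 * (real (card S) - (\<Sum>u\<in>V. A v u * x u))) - (\<Sum>v\<in>L. y v * y v)"
    using lhs_le by linarith
  also have "\<dots> = ?rhs"
    unfolding L_def[symmetric] S_def[symmetric] A_def[symmetric] sum_subtractf[symmetric]
    by (intro sum.cong) (auto simp: y_def power2_eq_square algebra_simps)
  finally show ?thesis .
qed

definition weight :: "'a set \<Rightarrow> real" where "weight \<sigma> = prod x \<sigma>"

lemma weight_pos: "\<sigma> \<subseteq> V \<Longrightarrow> weight \<sigma> > 0"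
  using x_pos by (auto simp: weight_def intro!: prod_pos)

lemma weight_insert: "finite \<sigma> \<Longrightarrow> v \<notin> \<sigma> \<Longrightarrow> weight (insert v \<sigma>) = x v * weight \<sigma>"
  by (simp add: weight_def)

text \<open>The vertices of the link of \<open>\<sigma>\<close>.\<close>

definition ext :: "'a set \<Rightarrow> 'a set" where "ext \<sigma> = {v\<in>V - \<sigma>. insert v \<sigma> \<in> X}"

lemma sum_delete: "(\<Sum>\<tau>\<in>faces X (Suc n). \<Sum>v\<in>\<tau>. F v (\<tau> - {v})) = (\<Sum>\<sigma>\<in>faces X n. \<Sum>v\<in>ext \<sigma>. F v \<sigma>)"
  for F :: "'a \<Rightarrow> 'a set \<Rightarrow> real"
  unfolding ext_def by (rule sum_faces_delete_vertex[OF X])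

lemma sum_delete_two:
  fixes G :: "'a \<Rightarrow> 'a \<Rightarrow> 'a set \<Rightarrow> real"
  shows "(\<Sum>\<sigma>\<in>faces X (Suc n). \<Sum>v\<in>ext \<sigma>. \<Sum>u\<in>\<sigma>. G v u (\<sigma> - {u}))
    = (\<Sum>\<eta>\<in>faces X n. \<Sum>u\<in>ext \<eta>. \<Sum>v\<in>ext (insert u \<eta>). G v u \<eta>)"
proof -
  have "(\<Sum>\<sigma>\<in>faces X (Suc n). \<Sum>v\<in>ext \<sigma>. \<Sum>u\<in>\<sigma>. G v u (\<sigma> - {u}))
    = (\<Sum>\<sigma>\<in>faces X (Suc n). \<Sum>u\<in>\<sigma>. \<Sum>v\<in>ext (insert u (\<sigma> - {u})). G v u (\<sigma> - {u}))"
    by (subst sum.swap) (auto intro!: sum.cong simp: insert_absorb)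
  also have "\<dots> = (\<Sum>\<eta>\<in>faces X n. \<Sum>u\<in>ext \<eta>. \<Sum>v\<in>ext (insert u \<eta>). G v u \<eta>)"
    by (rule sum_delete[of "\<lambda>u \<eta>. \<Sum>v\<in>ext (insert u \<eta>). G v u \<eta>"])
  finally show ?thesis .
qed

text \<open>The square of the coboundary at \<open>\<tau>\<close> is a sum over pairs of vertices of \<open>\<tau>\<close>. Equal
vertices give the first sum. Distinct \<open>v, u\<close> are regrouped by \<open>\<eta> = \<tau> - {v, u}\<close>, where the exchange of signs
produces the minus.\<close>

lemma coboundary_energy:
  "(\<Sum>\<tau>\<in>faces X (Suc (Suc n)). weight \<tau> * (coboundary f \<phi> \<tau>)\<^sup>2)
   = (\<Sum>\<sigma>\<in>faces X (Suc n). \<Sum>v\<in>ext \<sigma>. x v * (weight \<sigma> * (\<phi> \<sigma>)\<^sup>2))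
   - (\<Sum>\<eta>\<in>faces X n. weight \<eta> * (\<Sum>u\<in>V - \<eta>. \<Sum>v\<in>V - \<eta>. if u \<noteq> v \<and> insert v (insert u \<eta>) \<in> X
        then (x u * (insertion_sign f u \<eta> * \<phi> (insert u \<eta>))) * (x v * (insertion_sign f v \<eta> * \<phi> (insert v \<eta>))) else 0))"
proof -
  define s where "s = insertion_sign f"
  \<comment> \<open>\<open>F\<close> is one factor of the square written out; \<open>G\<close> is an off-diagonal term, indexed by the face that
is left after both vertices are removed.\<close>
  define F where "F v \<sigma> = weight (insert v \<sigma>) * (s v \<sigma> * \<phi> \<sigma>) * coboundary f \<phi> (insert v \<sigma>)" for v \<sigma>
  define G where "G v u \<eta> = weight (insert v (insert u \<eta>)) * (s v (insert u \<eta>) * \<phi> (insert u \<eta>))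
      * (s u (insert v \<eta>) * \<phi> (insert v \<eta>))" for v u \<eta>
  have "(\<Sum>\<tau>\<in>faces X (Suc (Suc n)). weight \<tau> * (coboundary f \<phi> \<tau>)\<^sup>2)
      = (\<Sum>\<tau>\<in>faces X (Suc (Suc n)). \<Sum>v\<in>\<tau>. F v (\<tau> - {v}))"
  proof (rule sum.cong)
    fix \<tau>
    have "weight \<tau> * (coboundary f \<phi> \<tau>)\<^sup>2 = (\<Sum>v\<in>\<tau>. weight \<tau> * (s v (\<tau> - {v}) * \<phi> (\<tau> - {v})) * coboundary f \<phi> \<tau>)"
      unfolding power2_eq_square by (subst (1) coboundary_def) (simp add: s_def sum_distrib_left sum_distrib_right mult.assoc)
    then show "weight \<tau> * (coboundary f \<phi> \<tau>)\<^sup>2 = (\<Sum>v\<in>\<tau>. F v (\<tau> - {v}))"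
      by (simp add: F_def insert_absorb)
  qed simp
  also have "\<dots> = (\<Sum>\<sigma>\<in>faces X (Suc n). \<Sum>v\<in>ext \<sigma>. F v \<sigma>)" by (rule sum_delete[of F])
  also have "\<dots> = (\<Sum>\<sigma>\<in>faces X (Suc n). \<Sum>v\<in>ext \<sigma>. x v * (weight \<sigma> * (\<phi> \<sigma>)\<^sup>2) + (\<Sum>u\<in>\<sigma>. G v u (\<sigma> - {u})))"
  proof (intro sum.cong refl)
    fix \<sigma> v assume \<sigma>: "\<sigma> \<in> faces X (Suc n)" and v: "v \<in> ext \<sigma>"
    have fin: "finite \<sigma>" and v': "v \<notin> \<sigma>" using \<sigma> v fin_face by (auto simp: faces_def ext_def)
    have del: "insert v \<sigma> - {u} = insert v (\<sigma> - {u})" if "u \<in> \<sigma>" for u using that v' by auto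
    have "coboundary f \<phi> (insert v \<sigma>) = s v \<sigma> * \<phi> \<sigma> + (\<Sum>u\<in>\<sigma>. s u (insert v (\<sigma> - {u})) * \<phi> (insert v (\<sigma> - {u})))"
      unfolding coboundary_def s_def[symmetric] using fin v' by (simp add: del)
    then have "F v \<sigma> = weight (insert v \<sigma>) * (s v \<sigma> * s v \<sigma>) * (\<phi> \<sigma>)\<^sup>2
        + (\<Sum>u\<in>\<sigma>. weight (insert v \<sigma>) * (s v \<sigma> * \<phi> \<sigma>) * (s u (insert v (\<sigma> - {u})) * \<phi> (insert v (\<sigma> - {u}))))"
      unfolding F_def by (simp add: distrib_left power2_eq_square sum_distrib_left)
    moreover have "(\<Sum>u\<in>\<sigma>. G v u (\<sigma> - {u})) = (\<Sum>u\<in>\<sigma>. weight (insert v \<sigma>) * (s v \<sigma> * \<phi> \<sigma>)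
        * (s u (insert v (\<sigma> - {u})) * \<phi> (insert v (\<sigma> - {u}))))"
      by (intro sum.cong) (auto simp: G_def insert_absorb)
    ultimately show "F v \<sigma> = x v * (weight \<sigma> * (\<phi> \<sigma>)\<^sup>2) + (\<Sum>u\<in>\<sigma>. G v u (\<sigma> - {u}))"
      using weight_insert[OF fin v'] by (simp add: s_def)
  qed
  also have "\<dots> = (\<Sum>\<sigma>\<in>faces X (Suc n). \<Sum>v\<in>ext \<sigma>. x v * (weight \<sigma> * (\<phi> \<sigma>)\<^sup>2))
      + (\<Sum>\<eta>\<in>faces X n. \<Sum>u\<in>ext \<eta>. \<Sum>v\<in>ext (insert u \<eta>). G v u \<eta>)"
    by (simp only: sum.distrib sum_delete_two)
  also have "(\<Sum>\<eta>\<in>faces X n. \<Sum>u\<in>ext \<eta>. \<Sum>v\<in>ext (insert u \<eta>). G v u \<eta>)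
     = (\<Sum>\<eta>\<in>faces X n. - (weight \<eta> * (\<Sum>u\<in>V - \<eta>. \<Sum>v\<in>V - \<eta>. if u \<noteq> v \<and> insert v (insert u \<eta>) \<in> X
        then (x u * (s u \<eta> * \<phi> (insert u \<eta>))) * (x v * (s v \<eta> * \<phi> (insert v \<eta>))) else 0)))"
  proof (rule sum.cong)
    fix \<eta> assume "\<eta> \<in> faces X n"
    then have fin: "finite \<eta>" using fin_face by (auto simp: faces_def)
    define T where "T u v = (x u * (s u \<eta> * \<phi> (insert u \<eta>))) * (x v * (s v \<eta> * \<phi> (insert v \<eta>)))" for u v
    have "(\<Sum>u\<in>V - \<eta>. \<Sum>v\<in>V - \<eta>. if u \<noteq> v \<and> insert v (insert u \<eta>) \<in> X then T u v else 0)
        = (\<Sum>u\<in>ext \<eta>. \<Sum>v\<in>V - \<eta>. if u \<noteq> v \<and> insert v (insert u \<eta>) \<in> X then T u v else 0)"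
    proof (rule sum.mono_neutral_right)
      show "\<forall>u\<in>(V - \<eta>) - ext \<eta>. (\<Sum>v\<in>V - \<eta>. if u \<noteq> v \<and> insert v (insert u \<eta>) \<in> X then T u v else 0) = 0"
      proof (intro ballI sum.neutral)
        fix u v assume "u \<in> (V - \<eta>) - ext \<eta>" "v \<in> V - \<eta>"
        then have "insert u \<eta> \<notin> X" by (auto simp: ext_def)
        then have "insert v (insert u \<eta>) \<notin> X" using X_down[OF _ subset_insertI[of "insert u \<eta>" v]] by blast
        then show "(if u \<noteq> v \<and> insert v (insert u \<eta>) \<in> X then T u v else 0) = 0" by simp
      qed
    qed (auto simp: fin_V ext_def)
    also have "\<dots> = (\<Sum>u\<in>ext \<eta>. \<Sum>v\<in>ext (insert u \<eta>). T u v)"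
    proof (rule sum.cong)
      fix u
      show "(\<Sum>v\<in>V - \<eta>. if u \<noteq> v \<and> insert v (insert u \<eta>) \<in> X then T u v else 0) = (\<Sum>v\<in>ext (insert u \<eta>). T u v)"
        using fin_V by (intro sum.mono_neutral_cong_right) (auto simp: ext_def)
    qed simp
    finally have "weight \<eta> * (\<Sum>u\<in>V - \<eta>. \<Sum>v\<in>V - \<eta>. if u \<noteq> v \<and> insert v (insert u \<eta>) \<in> X then T u v else 0)
        = (\<Sum>u\<in>ext \<eta>. \<Sum>v\<in>ext (insert u \<eta>). weight \<eta> * T u v)"
      by (simp add: sum_distrib_left)
    moreover have "G v u \<eta> = - (weight \<eta> * T u v)" if "u \<in> ext \<eta>" "v \<in> ext (insert u \<eta>)" for u v
    proof -
      have uv: "u \<notin> \<eta>" "v \<notin> \<eta>" "u \<noteq> v" "f u \<noteq> f v" using that inj by (auto simp: ext_def dest: inj_onD)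
      have w: "weight (insert v (insert u \<eta>)) = x v * (x u * weight \<eta>)"
        using uv fin by (simp add: weight_insert)
      have "G v u \<eta> = weight (insert v (insert u \<eta>)) * (s u (insert v \<eta>) * s v (insert u \<eta>)) * \<phi> (insert u \<eta>) * \<phi> (insert v \<eta>)"
        by (simp add: G_def)
      also have "s u (insert v \<eta>) * s v (insert u \<eta>) = - (s u \<eta> * s v \<eta>)"
        unfolding s_def by (rule insertion_sign_exchange[OF fin uv(1,2,4)])
      finally show ?thesis unfolding w T_def by simp
    qed
    ultimately show "(\<Sum>u\<in>ext \<eta>. \<Sum>v\<in>ext (insert u \<eta>). G v u \<eta>)
      = - (weight \<eta> * (\<Sum>u\<in>V - \<eta>. \<Sum>v\<in>V - \<eta>. if u \<noteq> v \<and> insert v (insert u \<eta>) \<in> X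
        then (x u * (s u \<eta> * \<phi> (insert u \<eta>))) * (x v * (s v \<eta> * \<phi> (insert v \<eta>))) else 0))"
      unfolding T_def[symmetric] by (simp add: sum_negf)
  qed simp
  finally show ?thesis by (simp only: s_def sum_negf add_uminus_conv_diff)
qed

text \<open>Every vertex is in \<open>\<sigma>\<close>, or extends \<open>\<sigma>\<close>, or is blocked from some facet of \<open>\<sigma>\<close> together with the vertex opposite to it.\<close>

lemma vertex_weights_covered:
  assumes "\<sigma> \<in> X"
  shows "(\<Sum>v\<in>V. x v) \<le> (\<Sum>v\<in>ext \<sigma>. x v) + (\<Sum>v\<in>\<sigma>. x v)
    + (\<Sum>v\<in>\<sigma>. \<Sum>u\<in>V. of_bool (blocked V X (\<sigma> - {v}) v u) * x u)"
proof -
  define N where "N = {u\<in>V - \<sigma>. insert u \<sigma> \<notin> X}"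
  have "\<sigma> \<subseteq> V" "finite \<sigma>" using assms X_sub fin_face by auto
  then have "V = ext \<sigma> \<union> \<sigma> \<union> N" "(ext \<sigma> \<union> \<sigma>) \<inter> N = {}" "ext \<sigma> \<inter> \<sigma> = {}" "finite (ext \<sigma>)" "finite N"
    using fin_V by (auto simp: ext_def N_def)
  then have "(\<Sum>v\<in>V. x v) = (\<Sum>v\<in>ext \<sigma>. x v) + (\<Sum>v\<in>\<sigma>. x v) + (\<Sum>v\<in>N. x v)"
    using \<open>finite \<sigma>\<close> by (metis finite_Un sum.union_disjoint)
  moreover have "(\<Sum>u\<in>N. x u) \<le> (\<Sum>u\<in>N. \<Sum>v\<in>\<sigma>. of_bool (blocked V X (\<sigma> - {v}) v u) * x u)"
  proof (rule sum_mono)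
    fix u assume u: "u \<in> N"
    then obtain v where v: "v \<in> \<sigma>" "blocked V X (\<sigma> - {v}) v u"
      using non_extending_vertex_blocked[OF X assms, of u] by (auto simp: N_def)
    have "x u > 0" using u x_pos by (auto simp: N_def)
    have "x u = of_bool (blocked V X (\<sigma> - {v}) v u) * x u" using v by simp
    also have "\<dots> \<le> (\<Sum>v\<in>\<sigma>. of_bool (blocked V X (\<sigma> - {v}) v u) * x u)"
      using v \<open>finite \<sigma>\<close> \<open>x u > 0\<close>
      by (intro member_le_sum[of v \<sigma> "\<lambda>v. of_bool (blocked V X (\<sigma> - {v}) v u) * x u"]) auto
    finally show "x u \<le> (\<Sum>v\<in>\<sigma>. of_bool (blocked V X (\<sigma> - {v}) v u) * x u)" .
  qed
  moreover have "\<dots> \<le> (\<Sum>u\<in>V. \<Sum>v\<in>\<sigma>. of_bool (blocked V X (\<sigma> - {v}) v u) * x u)"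
    using fin_V x_pos by (intro sum_mono2) (auto simp: N_def less_imp_le intro!: sum_nonneg)
  moreover have "\<dots> = (\<Sum>v\<in>\<sigma>. \<Sum>u\<in>V. of_bool (blocked V X (\<sigma> - {v}) v u) * x u)" by (rule sum.swap)
  ultimately show ?thesis by linarith
qed

text \<open>Inserting \<open>link_estimate\<close> into \<open>coboundary_energy\<close> and moving everything to faces of
size \<open>n + 1\<close>, the coefficient of the energy \<open>E \<sigma>\<close> is at least the total weight minus \<open>(n + 1) * N\<close>, which is
positive.\<close>

lemma harmonic_cochain_zero:
  assumes supp: "\<And>\<sigma>. \<phi> \<sigma> \<noteq> 0 \<Longrightarrow> \<sigma> \<in> faces X (Suc n)"
    and closed: "\<And>\<tau>. \<tau> \<in> faces X (Suc (Suc n)) \<Longrightarrow> coboundary f \<phi> \<tau> = 0"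
    and coclosed: "\<And>\<eta>. \<eta> \<in> faces X n \<Longrightarrow> (\<Sum>v\<in>V - \<eta>. x v * (insertion_sign f v \<eta> * \<phi> (insert v \<eta>))) = 0"
    and large: "(\<Sum>v\<in>V. x v) > real (\<Sum>r\<in>missing_dims V X. r * (Suc n choose r))"
  shows "\<phi> \<sigma> = 0"
proof -
  \<comment> \<open>The number of indices of the representation below a face of size \<open>n\<close>.\<close>
  define N where "N = real (\<Sum>r\<in>missing_dims V X. n choose (r - 1))"
  define b where "b \<eta> v = (\<Sum>u\<in>V. of_bool (blocked V X \<eta> v u) * x u)" for \<eta> v
  define E where "E \<sigma> = weight \<sigma> * (\<phi> \<sigma>)\<^sup>2" for \<sigma>
  have N: "real (Suc n) * N < (\<Sum>v\<in>V. x v)"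
    using large unfolding N_def sum_binomial_absorb[OF X, symmetric] by (simp only: of_nat_mult)
  have E_nonneg: "E \<sigma> \<ge> 0" if "\<sigma> \<in> X" for \<sigma>
    using weight_pos[OF X_sub[OF that]] by (simp add: E_def)
  have link: "weight \<eta> * (\<Sum>u\<in>V - \<eta>. \<Sum>v\<in>V - \<eta>. if u \<noteq> v \<and> insert v (insert u \<eta>) \<in> X
        then (x u * (insertion_sign f u \<eta> * \<phi> (insert u \<eta>))) * (x v * (insertion_sign f v \<eta> * \<phi> (insert v \<eta>))) else 0)
      \<le> (\<Sum>v\<in>ext \<eta>. E (insert v \<eta>) * (N - x v - b \<eta> v))" if "\<eta> \<in> faces X n" for \<eta>
  proof -
    have \<eta>: "\<eta> \<in> X" "card \<eta> = n" "finite \<eta>" "\<eta> \<subseteq> V" using that fin_face X_sub by (auto simp: faces_def)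
    let ?g = "\<lambda>v. insertion_sign f v \<eta> * \<phi> (insert v \<eta>)"
    have g: "(?g v)\<^sup>2 = (\<phi> (insert v \<eta>))\<^sup>2" for v
      by (simp add: power2_eq_square)
    have "(\<Sum>u\<in>V - \<eta>. \<Sum>v\<in>V - \<eta>. if u \<noteq> v \<and> insert v (insert u \<eta>) \<in> X then (x u * ?g u) * (x v * ?g v) else 0)
      \<le> (\<Sum>v\<in>V - \<eta>. x v * (?g v)\<^sup>2 * (real (card {\<sigma>\<in>rep_index V X. \<sigma> \<subseteq> \<eta>}) - x v - b \<eta> v))"
      unfolding b_def
    proof (rule link_estimate[OF \<eta>(1) _ coclosed[OF that]])
      fix v assume "insert v \<eta> \<notin> X"
      then show "?g v = 0" using supp[of "insert v \<eta>"] by (auto simp: faces_def)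
    qed
    also have "\<dots> = (\<Sum>v\<in>V - \<eta>. x v * (\<phi> (insert v \<eta>))\<^sup>2 * (N - x v - b \<eta> v))"
      unfolding g card_rep_index_below[OF X \<eta>(4)] \<eta>(2) N_def ..
    also have "\<dots> = (\<Sum>v\<in>ext \<eta>. x v * (\<phi> (insert v \<eta>))\<^sup>2 * (N - x v - b \<eta> v))"
      using fin_V supp by (intro sum.mono_neutral_right) (auto simp: ext_def faces_def)
    finally have "weight \<eta> * (\<Sum>u\<in>V - \<eta>. \<Sum>v\<in>V - \<eta>. if u \<noteq> v \<and> insert v (insert u \<eta>) \<in> X then (x u * ?g u) * (x v * ?g v) else 0)
      \<le> weight \<eta> * (\<Sum>v\<in>ext \<eta>. x v * (\<phi> (insert v \<eta>))\<^sup>2 * (N - x v - b \<eta> v))"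
      using weight_pos[OF \<eta>(4)] by (simp add: mult_left_mono)
    also have "\<dots> = (\<Sum>v\<in>ext \<eta>. E (insert v \<eta>) * (N - x v - b \<eta> v))"
      unfolding sum_distrib_left E_def
      by (intro sum.cong) (auto simp: ext_def weight_insert[OF \<eta>(3)])
    finally show ?thesis .
  qed
  have "0 = (\<Sum>\<tau>\<in>faces X (Suc (Suc n)). weight \<tau> * (coboundary f \<phi> \<tau>)\<^sup>2)"
    using closed by simp
  also have "\<dots> \<ge> (\<Sum>\<sigma>\<in>faces X (Suc n). \<Sum>v\<in>ext \<sigma>. x v * E \<sigma>)
      - (\<Sum>\<eta>\<in>faces X n. \<Sum>v\<in>ext \<eta>. E (insert v \<eta>) * (N - x v - b \<eta> v))"
    unfolding coboundary_energy E_def[symmetric] by (intro diff_left_mono sum_mono link)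
  also have "(\<Sum>\<eta>\<in>faces X n. \<Sum>v\<in>ext \<eta>. E (insert v \<eta>) * (N - x v - b \<eta> v))
      = (\<Sum>\<sigma>\<in>faces X (Suc n). \<Sum>v\<in>\<sigma>. E \<sigma> * (N - x v - b (\<sigma> - {v}) v))"
    by (subst sum_delete[symmetric]) (auto intro!: sum.cong simp: insert_absorb)
  finally have "(\<Sum>\<sigma>\<in>faces X (Suc n). \<Sum>v\<in>ext \<sigma>. x v * E \<sigma>)
      - (\<Sum>\<sigma>\<in>faces X (Suc n). \<Sum>v\<in>\<sigma>. E \<sigma> * (N - x v - b (\<sigma> - {v}) v)) \<le> 0" .
  moreover have "(\<Sum>\<sigma>\<in>faces X (Suc n). E \<sigma> * ((\<Sum>v\<in>V. x v) - real (Suc n) * N))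
      \<le> (\<Sum>\<sigma>\<in>faces X (Suc n). \<Sum>v\<in>ext \<sigma>. x v * E \<sigma>)
        - (\<Sum>\<sigma>\<in>faces X (Suc n). \<Sum>v\<in>\<sigma>. E \<sigma> * (N - x v - b (\<sigma> - {v}) v))"
    unfolding sum_subtractf[symmetric]
  proof (rule sum_mono)
    fix \<sigma> assume \<sigma>: "\<sigma> \<in> faces X (Suc n)"
    then have \<sigma>X: "\<sigma> \<in> X" "card \<sigma> = Suc n" by (auto simp: faces_def)
    have "(\<Sum>v\<in>ext \<sigma>. x v * E \<sigma>) - (\<Sum>v\<in>\<sigma>. E \<sigma> * (N - x v - b (\<sigma> - {v}) v))
      = E \<sigma> * ((\<Sum>v\<in>ext \<sigma>. x v) - (\<Sum>v\<in>\<sigma>. N - x v - b (\<sigma> - {v}) v))"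
      by (subst right_diff_distrib) (simp only: sum_distrib_left sum_distrib_right mult.commute)
    also have "(\<Sum>v\<in>\<sigma>. N - x v - b (\<sigma> - {v}) v) = real (Suc n) * N - (\<Sum>v\<in>\<sigma>. x v) - (\<Sum>v\<in>\<sigma>. b (\<sigma> - {v}) v)"
      using \<sigma>X by (simp add: sum_subtractf)
    also have "E \<sigma> * ((\<Sum>v\<in>V. x v) - real (Suc n) * N) \<le> E \<sigma> * ((\<Sum>v\<in>ext \<sigma>. x v) - \<dots>)"
      using vertex_weights_covered[OF \<sigma>X(1)] E_nonneg[OF \<sigma>X(1)]
      unfolding b_def by (intro mult_left_mono) linarith+
    finally show "E \<sigma> * ((\<Sum>v\<in>V. x v) - real (Suc n) * N)
      \<le> (\<Sum>v\<in>ext \<sigma>. x v * E \<sigma>) - (\<Sum>v\<in>\<sigma>. E \<sigma> * (N - x v - b (\<sigma> - {v}) v))" .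
  qed
  ultimately have "(\<Sum>\<sigma>\<in>faces X (Suc n). E \<sigma> * ((\<Sum>v\<in>V. x v) - real (Suc n) * N)) \<le> 0"
    by linarith
  moreover have nonneg: "E \<sigma> * ((\<Sum>v\<in>V. x v) - real (Suc n) * N) \<ge> 0" if "\<sigma> \<in> faces X (Suc n)" for \<sigma>
    using E_nonneg N that by (auto simp: faces_def)
  ultimately have total: "(\<Sum>\<sigma>\<in>faces X (Suc n). E \<sigma> * ((\<Sum>v\<in>V. x v) - real (Suc n) * N)) = 0"
    by (intro antisym sum_nonneg)
  have zero: "E \<sigma> * ((\<Sum>v\<in>V. x v) - real (Suc n) * N) = 0" if "\<sigma> \<in> faces X (Suc n)" for \<sigma>
    by (rule sum_nonneg_0[OF fin_faces nonneg total that])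
  have "\<phi> \<sigma> = 0" if \<sigma>: "\<sigma> \<in> faces X (Suc n)"
  proof -
    have "E \<sigma> = 0" using zero[OF \<sigma>] N by simp
    moreover have "weight \<sigma> > 0" using \<sigma> weight_pos X_sub by (simp add: faces_def)
    ultimately show ?thesis by (simp add: E_def)
  qed
  then show ?thesis using supp by blast
qed

text \<open>The vanishing theorem. The residual \<open>r\<close> of the projection of \<open>z\<close> to the boundaries is a cycle, and
orthogonality with respect to the weights \<open>1 / weight \<sigma>\<close> makes \<open>r \<sigma> / weight \<sigma>\<close> a
cocycle. The division by the weights identifies chains with cochains, and under it the plain boundary
becomes the weighted adjoint of the coboundary.\<close>

theorem cycle_is_boundary:
  assumes z: "chain X (Suc n) z" and cycle: "\<And>\<eta>. \<eta> \<in> faces X n \<Longrightarrow> boundary f V z \<eta> = 0"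
    and large: "(\<Sum>v\<in>V. x v) > real (\<Sum>r\<in>missing_dims V X. r * (Suc n choose r))"
  shows "\<exists>c. chain X (Suc (Suc n)) c \<and> (\<forall>\<sigma>. boundary f V c \<sigma> = z \<sigma>)"
proof -
  define ind where "ind \<tau> = (\<lambda>\<tau>'. of_bool (\<tau>' = \<tau>) :: real)" for \<tau> :: "'a set"
  have "\<exists>a. \<forall>\<tau>\<in>faces X (Suc (Suc n)). (\<Sum>\<sigma>\<in>faces X (Suc n). 1 / weight \<sigma>
      * (z \<sigma> - (\<Sum>i\<in>faces X (Suc (Suc n)). a i * boundary f V (ind i) \<sigma>)) * boundary f V (ind \<tau>) \<sigma>) = 0"
    using X_sub weight_pos by (intro weighted_projection fin_faces) (auto simp: faces_def)
  then obtain a where a: "\<And>\<tau>. \<tau> \<in> faces X (Suc (Suc n)) \<Longrightarrow> (\<Sum>\<sigma>\<in>faces X (Suc n). 1 / weight \<sigma>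
      * (z \<sigma> - (\<Sum>i\<in>faces X (Suc (Suc n)). a i * boundary f V (ind i) \<sigma>)) * boundary f V (ind \<tau>) \<sigma>) = 0"
    by blast
  define c where "c = (\<lambda>\<tau>. \<Sum>i\<in>faces X (Suc (Suc n)). a i * ind i \<tau>)"
  define r where "r \<sigma> = z \<sigma> - boundary f V c \<sigma>" for \<sigma>
  have bd_c: "boundary f V c \<sigma> = (\<Sum>i\<in>faces X (Suc (Suc n)). a i * boundary f V (ind i) \<sigma>)" for \<sigma>
    unfolding c_def by (rule boundary_linear)
  have c: "chain X (Suc (Suc n)) c"
    unfolding chain_def
  proof (intro allI impI)
    fix \<sigma> assume "c \<sigma> \<noteq> 0"
    then obtain i where "i \<in> faces X (Suc (Suc n))" "a i * ind i \<sigma> \<noteq> 0"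
      unfolding c_def by (meson sum.not_neutral_contains_not_neutral)
    then show "\<sigma> \<in> faces X (Suc (Suc n))" by (simp add: ind_def split: if_splits)
  qed
  have r_supp: "\<sigma> \<in> faces X (Suc n)" if "r \<sigma> \<noteq> 0" for \<sigma>
    using that z chain_boundary[OF X c] unfolding r_def chain_def by force
  have "r \<sigma> / weight \<sigma> = 0" for \<sigma>
  proof (rule harmonic_cochain_zero[OF _ _ _ large])
    fix \<tau> assume \<tau>: "\<tau> \<in> faces X (Suc (Suc n))"
    have "chain X (Suc (Suc n)) (ind \<tau>)" using \<tau> by (auto simp: chain_def ind_def)
    from boundary_coboundary_adjoint[OF X this, of f "\<lambda>\<sigma>. r \<sigma> / weight \<sigma>"]
    have "(\<Sum>\<tau>'\<in>faces X (Suc (Suc n)). ind \<tau> \<tau>' * coboundary f (\<lambda>\<sigma>. r \<sigma> / weight \<sigma>) \<tau>')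
       = (\<Sum>\<sigma>\<in>faces X (Suc n). boundary f V (ind \<tau>) \<sigma> * (r \<sigma> / weight \<sigma>))" by simp
    also have "\<dots> = (\<Sum>\<sigma>\<in>faces X (Suc n). 1 / weight \<sigma> * r \<sigma> * boundary f V (ind \<tau>) \<sigma>)"
      by (intro sum.cong) simp_all
    also have "\<dots> = 0" using a[OF \<tau>] by (simp only: r_def bd_c)
    finally have "(\<Sum>\<tau>'\<in>faces X (Suc (Suc n)). ind \<tau> \<tau>' * coboundary f (\<lambda>\<sigma>. r \<sigma> / weight \<sigma>) \<tau>') = 0" .
    moreover have "ind \<tau> \<tau>' * h \<tau>' = (if \<tau>' = \<tau> then h \<tau>' else 0)" for h \<tau>' by (simp add: ind_def)
    ultimately show "coboundary f (\<lambda>\<sigma>. r \<sigma> / weight \<sigma>) \<tau> = 0"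
      using \<tau> fin_faces[of "Suc (Suc n)"] by (simp only: sum.delta if_True)
  next
    fix \<eta> assume \<eta>: "\<eta> \<in> faces X n"
    then have \<eta>': "\<eta> \<subseteq> V" "finite \<eta>" using X_sub fin_face by (auto simp: faces_def)
    have "(\<Sum>v\<in>V - \<eta>. x v * (insertion_sign f v \<eta> * (r (insert v \<eta>) / weight (insert v \<eta>))))
      = (\<Sum>v\<in>V - \<eta>. insertion_sign f v \<eta> * r (insert v \<eta>)) / weight \<eta>"
      unfolding sum_divide_distrib using x_pos
      by (intro sum.cong) (auto simp: weight_insert[OF \<eta>'(2)] less_imp_neq[THEN not_sym])
    also have "(\<Sum>v\<in>V - \<eta>. insertion_sign f v \<eta> * r (insert v \<eta>)) = boundary f V r \<eta>"
      by (simp add: boundary_def)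
    also have "boundary f V r \<eta> = boundary f V z \<eta> - boundary f V (boundary f V c) \<eta>"
      unfolding r_def by (rule boundary_diff)
    also have "\<dots> = 0" using cycle[OF \<eta>] boundary_boundary[OF fin_V inj \<eta>'(1)] by simp
    finally show "(\<Sum>v\<in>V - \<eta>. x v * (insertion_sign f v \<eta> * (r (insert v \<eta>) / weight (insert v \<eta>)))) = 0" by simp
  qed (use r_supp in auto)
  then have quot: "r \<sigma> / weight \<sigma> = 0" for \<sigma> .
  have "r \<sigma> = 0" for \<sigma>
  proof (rule ccontr)
    assume "r \<sigma> \<noteq> 0"
    then have "weight \<sigma> > 0" using r_supp X_sub weight_pos by (simp add: faces_def)
    then show False using quot[of \<sigma>] \<open>r \<sigma> \<noteq> 0\<close> by simp
  qed
  then show ?thesis using c by (auto simp: r_def)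
qed

end

section \<open>From vector domination to acyclicity\<close>

lemma gram_matrix_psd:
  fixes p :: "'a \<Rightarrow> real vec"
  assumes "\<And>v. v \<in> L \<Longrightarrow> p v \<in> carrier_vec l"
  shows "(\<Sum>v\<in>L. \<Sum>u\<in>L. scalar_prod (p v) (p u) * (y v * y u)) \<ge> 0"
proof -
  have "(\<Sum>v\<in>L. \<Sum>u\<in>L. scalar_prod (p v) (p u) * (y v * y u))
      = (\<Sum>v\<in>L. \<Sum>u\<in>L. \<Sum>k<l. (y v * p v $ k) * (y u * p u $ k))"
  proof (intro sum.cong refl)
    fix v u assume "v \<in> L" "u \<in> L"
    then have "dim_vec (p u) = l" using assms carrier_vecD by blast
    then show "scalar_prod (p v) (p u) * (y v * y u) = (\<Sum>k<l. (y v * p v $ k) * (y u * p u $ k))"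
      unfolding scalar_prod_def sum_distrib_right by (intro sum.cong) auto
  qed
  also have "\<dots> = (\<Sum>v\<in>L. \<Sum>k<l. \<Sum>u\<in>L. (y v * p v $ k) * (y u * p u $ k))"
    by (intro sum.cong refl sum.swap)
  also have "\<dots> = (\<Sum>k<l. \<Sum>v\<in>L. \<Sum>u\<in>L. (y v * p v $ k) * (y u * p u $ k))"
    by (rule sum.swap)
  also have "\<dots> = (\<Sum>k<l. (\<Sum>v\<in>L. y v * p v $ k)\<^sup>2)"
    by (simp only: power2_eq_square sum_product)
  also have "\<dots> \<ge> 0" by (intro sum_nonneg) simp
  finally show ?thesis .
qed

lemma finite_rep_index: "finite V \<Longrightarrow> finite (rep_index V X)"
  by (rule finite_subset[of _ "Pow V"]) (auto simp: rep_index_def)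

text \<open>A representation \<open>P\<close> with value above \<open>b\<close> exists by definition of the supremum; its value is the
optimum of a covering program with variables indexed by pairs \<open>(\<sigma>, v)\<close>, whose dual has the
vertex weights \<open>x\<close> as variables.\<close>

lemma vector_domination_dual_weights:
  assumes "finite V" and large: "ereal b < vector_domination V X"
  shows "\<exists>P x. vector_rep V X P \<and> (\<forall>v\<in>V. x v > 0) \<and>
    (\<forall>\<sigma>\<in>rep_index V X. \<forall>v\<in>V. (\<Sum>u\<in>V. scalar_prod (P \<sigma> v) (P \<sigma> u) * x u) \<le> 1) \<and>
    b < (\<Sum>v\<in>V. x v)"
proof -
  obtain P where P: "vector_rep V X P" and bP: "ereal b < rep_value V X P"
    using large unfolding vector_domination_def less_SUP_iff by blast
  define R where "R = rep_index V X \<times> V"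
  define a where "a = (\<lambda>(\<sigma>, v) u. scalar_prod (P \<sigma> v) (P \<sigma> u))"
  have R: "finite R" using assms(1) finite_rep_index unfolding R_def by blast
  have primal: "b < (\<Sum>r\<in>R. \<alpha> r)"
    if nonneg: "\<And>r. r \<in> R \<Longrightarrow> \<alpha> r \<ge> 0" and cover: "\<And>u. u \<in> V \<Longrightarrow> (\<Sum>r\<in>R. \<alpha> r * a r u) \<ge> 1" for \<alpha>
  proof -
    have "(\<Sum>\<sigma>\<in>rep_index V X. \<Sum>v\<in>V. \<alpha> (\<sigma>, v) * scalar_prod (P \<sigma> v) (P \<sigma> u)) = (\<Sum>r\<in>R. \<alpha> r * a r u)" for u
      unfolding R_def sum.cartesian_product by (intro sum.cong) (auto simp: a_def)
    then have "dominating V X P (\<lambda>\<sigma> v. \<alpha> (\<sigma>, v))"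
      unfolding dominating_def using nonneg cover by (auto simp: R_def)
    then have "rep_value V X P \<le> ereal (\<Sum>\<sigma>\<in>rep_index V X. \<Sum>v\<in>V. \<alpha> (\<sigma>, v))"
      unfolding rep_value_def by (intro INF_lower) simp
    also have "(\<Sum>\<sigma>\<in>rep_index V X. \<Sum>v\<in>V. \<alpha> (\<sigma>, v)) = (\<Sum>r\<in>R. \<alpha> r)"
      unfolding R_def sum.cartesian_product by (intro sum.cong) auto
    finally have "ereal b < ereal (\<Sum>r\<in>R. \<alpha> r)" using bP by (rule_tac less_le_trans)
    then show ?thesis by simp
  qed
  show ?thesis
  proof (rule lp_duality[OF R assms(1), of a b])
    fix x assume x: "\<And>u. u \<in> V \<Longrightarrow> x u > 0" "\<And>r. r \<in> R \<Longrightarrow> (\<Sum>u\<in>V. a r u * x u) \<le> 1"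
      "b < (\<Sum>u\<in>V. x u)"
    have "(\<Sum>u\<in>V. scalar_prod (P \<sigma> v) (P \<sigma> u) * x u) \<le> 1" if "\<sigma> \<in> rep_index V X" "v \<in> V" for \<sigma> v
      using x(2)[of "(\<sigma>, v)"] that by (simp add: R_def a_def)
    then show ?thesis using P x(1,3) by (intro exI[of _ P] exI[of _ x]) simp
  qed (rule primal)
qed

lemma vector_rep_weighted_complex:
  assumes X: "finite_complex V X" and "inj_on f V" and P: "vector_rep V X P"
    and "\<And>v. v \<in> V \<Longrightarrow> x v > 0"
    and "\<And>\<sigma> v. \<lbrakk>\<sigma> \<in> rep_index V X; v \<in> V\<rbrakk> \<Longrightarrow> (\<Sum>u\<in>V. scalar_prod (P \<sigma> v) (P \<sigma> u) * x u) \<le> 1"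
  shows "weighted_complex V X f (\<lambda>\<sigma> v u. scalar_prod (P \<sigma> v) (P \<sigma> u)) x"
proof
  fix \<sigma> assume "\<sigma> \<in> rep_index V X"
  then have rep: "vector_rep_at V X \<sigma> (P \<sigma>)" using P by (simp add: vector_rep_def)
  then obtain l where l: "\<And>v. v \<in> V \<Longrightarrow> P \<sigma> v \<in> carrier_vec l" by (auto simp: vector_rep_at_def)
  have entry: "if {v, u} \<union> \<sigma> \<in> missing_faces V X (card \<sigma> + 1)
        then scalar_prod (P \<sigma> v) (P \<sigma> u) \<ge> 1 else scalar_prod (P \<sigma> v) (P \<sigma> u) \<ge> 0"
    if "v \<in> V" "u \<in> V" for v u
    using rep that unfolding vector_rep_at_def by blast
  show "scalar_prod (P \<sigma> v) (P \<sigma> u) = scalar_prod (P \<sigma> u) (P \<sigma> v)" if "v \<in> V" "u \<in> V" for v u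
    using comm_scalar_prod[OF l[OF that(1)] l[OF that(2)]] .
  show "scalar_prod (P \<sigma> v) (P \<sigma> u) \<ge> 0" if "v \<in> V" "u \<in> V" for v u
    using entry[OF that] by (simp split: if_splits)
  show "scalar_prod (P \<sigma> v) (P \<sigma> u) \<ge> 1"
    if "v \<in> V" "u \<in> V" "{v, u} \<union> \<sigma> \<in> missing_faces V X (card \<sigma> + 1)" for v u
    using entry[OF that(1,2)] that(3) by (simp only: if_True)
  show "0 \<le> (\<Sum>v\<in>L. \<Sum>u\<in>L. scalar_prod (P \<sigma> v) (P \<sigma> u) * (y v * y u))" if "L \<subseteq> V" for L y
    using gram_matrix_psd[of L "P \<sigma>" l y] l that by blast
qed (use assms in auto)

text \<open>For \<open>n = 0\<close> the claim is that the complex has a vertex, which holds because the total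
weight is positive.\<close>

theorem large_vector_domination_acyclic:
  assumes X: "finite_complex V X" and inj: "inj_on f V"
    and large: "vector_domination V X > ereal (\<Sum>r\<in>missing_dims V X. real (r * (n choose r)))"
    and z: "chain X n z" and cycle: "\<And>\<eta>. \<eta> \<in> X \<Longrightarrow> boundary f V z \<eta> = 0"
  shows "\<exists>c. chain X (Suc n) c \<and> (\<forall>\<sigma>. boundary f V c \<sigma> = z \<sigma>)"
proof -
  have fin: "finite V" using X by (simp add: finite_complex_def)
  obtain P x where P: "vector_rep V X P" and x_pos: "\<forall>v\<in>V. x v > 0"
    and Px: "\<forall>\<sigma>\<in>rep_index V X. \<forall>v\<in>V. (\<Sum>u\<in>V. scalar_prod (P \<sigma> v) (P \<sigma> u) * x u) \<le> 1"
    and x_large: "(\<Sum>r\<in>missing_dims V X. real (r * (n choose r))) < (\<Sum>v\<in>V. x v)"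
    using vector_domination_dual_weights[OF fin large] by (elim exE conjE)
  interpret weighted_complex V X f "\<lambda>\<sigma> v u. scalar_prod (P \<sigma> v) (P \<sigma> u)" x
    by (rule vector_rep_weighted_complex[OF X inj P]) (simp_all add: x_pos Px)
  show ?thesis
  proof (cases n)
    case (Suc k)
    show ?thesis unfolding Suc
    proof (rule cycle_is_boundary)
      show "chain X (Suc k) z" using z Suc by simp
      show "boundary f V z \<eta> = 0" if "\<eta> \<in> faces X k" for \<eta> using cycle that by (simp add: faces_def)
      show "real (\<Sum>r\<in>missing_dims V X. r * (Suc k choose r)) < (\<Sum>v\<in>V. x v)"
        using x_large Suc by (simp only: of_nat_sum)
    qed
  next
    case 0
    have "(\<Sum>r\<in>missing_dims V X. real (r * (n choose r))) \<ge> 0" by (intro sum_nonneg) simp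
    then have "V \<noteq> {}" using x_large by force
    then obtain v where v: "v \<in> V" by blast
    define c where "c = (\<lambda>\<tau>. if \<tau> = {v} then z {} else 0)"
    have "chain X (Suc 0) c"
      using X v by (auto simp: chain_def c_def faces_def finite_complex_def)
    moreover have "boundary f V c \<sigma> = z \<sigma>" for \<sigma>
    proof (cases "\<sigma> = {}")
      case True
      have "boundary f V c {} = (\<Sum>w\<in>V. if w = v then z {} else 0)"
        unfolding boundary_def by (intro sum.cong) (auto simp: c_def insertion_sign_def)
      then show ?thesis using True v fin by simp
    next
      case False
      have "z \<sigma> = 0"
      proof (rule ccontr)
        assume "z \<sigma> \<noteq> 0"
        then have "\<sigma> \<in> X" "card \<sigma> = 0" using z 0 by (auto simp: chain_def faces_def)
        then show False using fin_face False by simp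
      qed
      moreover have "c (insert w \<sigma>) = 0" if "w \<in> V - \<sigma>" for w
        using that False by (auto simp: c_def)
      ultimately show ?thesis by (simp add: boundary_def)
    qed
    ultimately show ?thesis using 0 by blast
  qed
qed

section \<open>Rainbow simplices\<close>

lemma finite_complex_induced:
  assumes "finite_complex V X" "W \<subseteq> V"
  shows "finite_complex W (induced_complex X W)"
  using assms unfolding finite_complex_def induced_complex_def
  by (auto intro: finite_subset)

text \<open>As a cochain, the pull-back under the colouring of the elementary cochain of the simplex \<open>I\<close>. Signs are absent since
the vertex labelling is compatible with the order of the colours.\<close>

definition rainbow :: "('a \<Rightarrow> nat) \<Rightarrow> nat set \<Rightarrow> 'a set \<Rightarrow> real" where
  "rainbow colour I \<sigma> = of_bool (bij_betw colour \<sigma> I)"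

text \<open>Coboundary commutes with the pull-back. If \<open>\<tau>\<close> has one vertex of each colour, only the deletion of the vertex
coloured \<open>j\<close> contributes, with the sign computed on colours. If two vertices share a colour,
only their deletions can contribute; these two terms cancel, because no third vertex lies between the two
in the order.\<close>

lemma coboundary_rainbow:
  assumes fin: "finite \<tau>" and card: "card \<tau> = card I" and colours: "colour ` \<tau> \<subseteq> I" and j: "j \<in> I" "finite I"
    and order: "\<And>u v. u \<in> \<tau> \<Longrightarrow> v \<in> \<tau> \<Longrightarrow> colour u < colour v \<Longrightarrow> f u < f v" and inj: "inj_on f \<tau>"
  shows "coboundary f (rainbow colour (I - {j})) \<tau> = insertion_sign id j (I - {j}) * rainbow colour I \<tau>"
proof (cases "inj_on colour \<tau>")
  case True
  then have image: "colour ` \<tau> = I" using card colours j(2) fin by (metis card_image card_subset_eq)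
  then have bij: "bij_betw colour \<tau> I" using True by (simp add: bij_betw_def)
  obtain v where v: "v \<in> \<tau>" "colour v = j" using image j(1) by blast
  have other: "rainbow colour (I - {j}) (\<tau> - {w}) = 0" if "w \<in> \<tau>" "w \<noteq> v" for w
  proof -
    have "j \<in> colour ` (\<tau> - {w})" using v that by force
    then show ?thesis by (auto simp: rainbow_def bij_betw_def)
  qed
  have bij': "bij_betw colour (\<tau> - {v}) (I - {j})"
    using bij v by (metis bij_betw_DiffI bij_betw_singletonI empty_subsetI insert_subset j(1))
  have "bij_betw colour {u\<in>\<tau> - {v}. f u < f v} {i\<in>I - {j}. i < j}"
  proof (rule bij_betw_subset[OF bij', THEN bij_betw_cong[THEN iffD1, rotated]])
    show "{u\<in>\<tau> - {v}. f u < f v} \<subseteq> \<tau> - {v}" by blast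
    have less: "f u < f v \<longleftrightarrow> colour u < j" if "u \<in> \<tau> - {v}" for u
    proof -
      have "colour u \<noteq> j" using that v True by (auto dest: inj_onD)
      then show ?thesis using order[of u v] order[of v u] that v by (cases "colour u < j") auto
    qed
    show "colour ` {u\<in>\<tau> - {v}. f u < f v} = {i\<in>I - {j}. i < j}"
    proof -
      have "colour ` {u\<in>\<tau> - {v}. f u < f v} = {i\<in>colour ` (\<tau> - {v}). i < j}"
        using less by (auto simp del: Diff_iff)
      then show ?thesis using bij' by (simp add: bij_betw_def)
    qed
  qed simp
  then have sign: "insertion_sign f v (\<tau> - {v}) = insertion_sign id j (I - {j})"
    by (simp add: insertion_sign_def bij_betw_same_card)
  have "coboundary f (rainbow colour (I - {j})) \<tau>
      = (\<Sum>w\<in>\<tau>. if w = v then insertion_sign f v (\<tau> - {v}) else 0)"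
    unfolding coboundary_def using other bij' by (intro sum.cong) (auto simp: rainbow_def)
  also have "\<dots> = insertion_sign id j (I - {j})" using v fin sign by simp
  finally show ?thesis using bij by (simp add: rainbow_def)
next
  case False
  then obtain a b where ab: "a \<in> \<tau>" "b \<in> \<tau>" "a \<noteq> b" "colour a = colour b" by (auto simp: inj_on_def)
  define \<rho> where "\<rho> = \<tau> - {a, b}"
  have \<rho>: "\<tau> - {a} = insert b \<rho>" "\<tau> - {b} = insert a \<rho>" "a \<notin> \<rho>" "b \<notin> \<rho>" "finite \<rho>"
    using ab fin by (auto simp: \<rho>_def)
  define t where "t w = insertion_sign f w (\<tau> - {w}) * rainbow colour (I - {j}) (\<tau> - {w})" for w
  have "t w = 0" if "w \<in> \<tau> - {a, b}" for w
  proof -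
    have "\<not> inj_on colour (\<tau> - {w})" using ab that by (auto simp: inj_on_def)
    then show ?thesis by (simp add: t_def rainbow_def bij_betw_def)
  qed
  then have "coboundary f (rainbow colour (I - {j})) \<tau> = (\<Sum>w\<in>{a, b}. t w)"
    unfolding coboundary_def t_def[symmetric] using ab fin by (intro sum.mono_neutral_right) auto
  also have "\<dots> = t a + t b" using ab by simp
  also have "t a + t b = 0"
  proof -
    have same: "bij_betw colour (insert b \<rho>) (I - {j}) \<longleftrightarrow> bij_betw colour (insert a \<rho>) (I - {j})"
      using \<rho>(3,4) ab(4) by (simp add: bij_betw_def)
    show ?thesis
    proof (cases "bij_betw colour (insert b \<rho>) (I - {j})")
      case True
      then have "colour b \<notin> colour ` \<rho>" using \<rho>(4) by (simp add: bij_betw_def)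
      then have ne: "colour u \<noteq> colour b" if "u \<in> \<rho>" for u using that by (metis imageI)
      have "f u < f w \<longleftrightarrow> colour u < colour w" if "u \<in> \<tau>" "w \<in> \<tau>" "colour u \<noteq> colour w" for u w
        using order[of u w] order[of w u] that by (cases "colour u < colour w") auto
      then have "f u < f a \<longleftrightarrow> f u < f b" if "u \<in> \<rho>" for u
        using that ne[OF that] ab by (simp add: \<rho>_def)
      then have "{u\<in>\<rho>. f u < f a} = {u\<in>\<rho>. f u < f b}" by blast
      then have "insertion_sign f a \<rho> = insertion_sign f b \<rho>" by (simp add: insertion_sign_def)
      moreover have "f a \<noteq> f b" using ab inj by (auto dest: inj_onD)
      ultimately have "insertion_sign f a (insert b \<rho>) = - insertion_sign f b (insert a \<rho>)"
        using \<rho> by (auto simp: insertion_sign_insert)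
      then show ?thesis unfolding t_def \<rho>(1,2) rainbow_def same by simp
    next
      case False
      then show ?thesis unfolding t_def \<rho>(1,2) rainbow_def using same by simp
    qed
  qed
  finally have "coboundary f (rainbow colour (I - {j})) \<tau> = 0" .
  moreover have "rainbow colour I \<tau> = 0" using False by (simp add: rainbow_def bij_betw_def)
  ultimately show ?thesis by simp
qed

text \<open>The colouring as a map to the ordered set of colours, and a labelling of the vertices that refines it.\<close>

locale coloured_complex =
  fixes V :: "'a set" and X :: "'a set set" and f :: "'a \<Rightarrow> nat" and colour :: "'a \<Rightarrow> nat" and M :: "nat set"
  assumes X: "finite_complex V X" and inj: "inj_on f V" and finM: "finite M"
    and order: "\<And>u v. u \<in> V \<Longrightarrow> v \<in> V \<Longrightarrow> colour u < colour v \<Longrightarrow> f u < f v"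
begin

definition part :: "nat set \<Rightarrow> 'a set" where "part I = {v\<in>V. colour v \<in> I}"

definition subcomplex :: "nat set \<Rightarrow> 'a set set" where "subcomplex I = induced_complex X (part I)"

text \<open>A chain map from the simplex on the colours to \<open>X\<close>, carried by the subcomplexes \<open>subcomplex I\<close> and built up to degree
\<open>n\<close>.\<close>

definition colour_chains :: "(nat set \<Rightarrow> 'a set \<Rightarrow> real) \<Rightarrow> nat \<Rightarrow> bool" where
  "colour_chains c n \<longleftrightarrow> c {} = (\<lambda>\<sigma>. of_bool (\<sigma> = {})) \<and>
     (\<forall>I\<subseteq>M. card I \<le> n \<longrightarrow> chain (subcomplex I) (card I) (c I) \<and>
       (I \<noteq> {} \<longrightarrow> (\<forall>\<sigma>. boundary f V (c I) \<sigma> = (\<Sum>i\<in>I. insertion_sign id i (I - {i}) * c (I - {i}) \<sigma>))))"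

lemma boundary_part:
  assumes "chain (subcomplex I) n c"
  shows "boundary f (part I) c \<sigma> = boundary f V c \<sigma>"
  using assms X
  by (intro boundary_cong_support)
    (auto simp: chain_def faces_def subcomplex_def induced_complex_def part_def finite_complex_def)

lemma finite_colours: "I \<subseteq> M \<Longrightarrow> finite I"
  using finM finite_subset by blast

lemma chain_alternating_sum:
  assumes c: "colour_chains c n" and I: "I \<subseteq> M" "card I = Suc n"
  shows "chain (subcomplex I) n (\<lambda>\<sigma>. \<Sum>i\<in>I. insertion_sign id i (I - {i}) * c (I - {i}) \<sigma>)"
  unfolding chain_def
proof (intro allI impI)
  fix \<sigma> assume "(\<Sum>i\<in>I. insertion_sign id i (I - {i}) * c (I - {i}) \<sigma>) \<noteq> 0"
  then obtain i where i: "i \<in> I" "c (I - {i}) \<sigma> \<noteq> 0"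
    by (metis (no_types, lifting) mult_zero_right sum.neutral)
  have "I - {i} \<subseteq> M" "card (I - {i}) = n" using I i(1) by auto
  then have "\<sigma> \<in> faces (subcomplex (I - {i})) n"
    using c i(2) unfolding colour_chains_def chain_def by force
  then show "\<sigma> \<in> faces (subcomplex I) n"
    by (auto simp: faces_def subcomplex_def induced_complex_def part_def)
qed

text \<open>The alternating sum over the facets of \<open>I\<close> is a cycle: for \<open>n > 0\<close> the double sum over pairs of removed colours is
antisymmetric, and for \<open>n = 0\<close> it is the empty face, whose boundary is \<open>0\<close>.\<close>

lemma boundary_alternating_sum:
  assumes c: "colour_chains c n" and I: "I \<subseteq> M" "card I = Suc n"
  shows "boundary f V (\<lambda>\<sigma>. \<Sum>i\<in>I. insertion_sign id i (I - {i}) * c (I - {i}) \<sigma>) \<eta> = 0"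
proof (cases n)
  case 0
  then obtain i where "I = {i}" using I(2) card_1_singletonE by (metis One_nat_def)
  moreover have "c {} = (\<lambda>\<sigma>. of_bool (\<sigma> = {}))" using c by (simp add: colour_chains_def)
  ultimately show ?thesis by (simp add: boundary_def)
next
  case (Suc k)
  have step: "boundary f V (c (I - {i})) \<eta>
      = (\<Sum>j\<in>I - {i}. insertion_sign id j (I - {i} - {j}) * c (I - {i} - {j}) \<eta>)" if "i \<in> I" for i
  proof -
    have *: "I - {i} \<subseteq> M" "card (I - {i}) = n" using I that by auto
    then have "I - {i} \<noteq> {}" using Suc by force
    with * c show ?thesis unfolding colour_chains_def by simp
  qed
  have "boundary f V (\<lambda>\<sigma>. \<Sum>i\<in>I. insertion_sign id i (I - {i}) * c (I - {i}) \<sigma>) \<eta>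
     = (\<Sum>i\<in>I. insertion_sign id i (I - {i}) * boundary f V (c (I - {i})) \<eta>)"
    by (rule boundary_linear)
  also have "\<dots> = (\<Sum>i\<in>I. \<Sum>j\<in>I - {i}. insertion_sign id i (I - {i})
      * insertion_sign id j (I - {i} - {j}) * c (I - {i} - {j}) \<eta>)"
    using step by (simp add: sum_distrib_left mult.assoc)
  also have "\<dots> = 0"
  proof (rule sum_antisymmetric_pairs)
    fix i j assume ij: "i \<in> I" "j \<in> I" "i \<noteq> j"
    define K where "K = I - {i, j}"
    have K: "I - {i} = insert j K" "I - {j} = insert i K" "insert j K - {j} = K" "insert i K - {i} = K"
      "i \<notin> K" "j \<notin> K" "finite K"
      using ij finite_colours[OF I(1)] by (auto simp: K_def)
    show "insertion_sign id i (I - {i}) * insertion_sign id j (I - {i} - {j}) * c (I - {i} - {j}) \<eta>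
      = - (insertion_sign id j (I - {j}) * insertion_sign id i (I - {j} - {i}) * c (I - {j} - {i}) \<eta>)"
      using insertion_sign_anticommute[of K i j id] ij(3) K(5-7) unfolding K(1,2) K(3,4) by (simp add: mult.commute)
  qed (rule finite_colours[OF I(1)])
  finally show ?thesis .
qed

text \<open>One degree is added at a time: the alternating sum over the facets of \<open>I\<close> is a cycle in \<open>subcomplex I\<close>, and a
chain with this boundary is chosen there.\<close>

lemma colour_chains_exist:
  assumes acyclic: "\<And>I z. \<lbrakk>I \<subseteq> M; I \<noteq> {}; chain (subcomplex I) (card I - 1) z;
      \<And>\<eta>. \<eta> \<in> subcomplex I \<Longrightarrow> boundary f (part I) z \<eta> = 0\<rbrakk>
    \<Longrightarrow> \<exists>c. chain (subcomplex I) (card I) c \<and> (\<forall>\<sigma>. boundary f (part I) c \<sigma> = z \<sigma>)"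
  shows "\<exists>c. colour_chains c n"
proof (induction n)
  case 0
  have "chain (subcomplex {}) 0 (\<lambda>\<sigma>. of_bool (\<sigma> = {}))"
    using X by (auto simp: chain_def faces_def subcomplex_def induced_complex_def finite_complex_def)
  then have "colour_chains (\<lambda>I \<sigma>. of_bool (\<sigma> = {})) 0"
    unfolding colour_chains_def using finite_colours by auto
  then show ?case by blast
next
  case (Suc n)
  then obtain c where c: "colour_chains c n" by blast
  define z where "z I = (\<lambda>\<sigma>. \<Sum>i\<in>I. insertion_sign id i (I - {i}) * c (I - {i}) \<sigma>)" for I
  have "\<exists>d. chain (subcomplex I) (card I) d \<and> (\<forall>\<sigma>. boundary f (part I) d \<sigma> = z I \<sigma>)"
    if I: "I \<subseteq> M" "card I = Suc n" for I
  proof (rule acyclic)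
    show "I \<subseteq> M" "I \<noteq> {}" using I by auto
    have zI: "chain (subcomplex I) n (z I)" unfolding z_def by (rule chain_alternating_sum[OF c I])
    then show "chain (subcomplex I) (card I - 1) (z I)" using I by simp
    show "boundary f (part I) (z I) \<eta> = 0" for \<eta>
      unfolding boundary_part[OF zI] unfolding z_def by (rule boundary_alternating_sum[OF c I])
  qed
  then obtain d where d: "\<And>I. I \<subseteq> M \<Longrightarrow> card I = Suc n \<Longrightarrow>
      chain (subcomplex I) (card I) (d I) \<and> (\<forall>\<sigma>. boundary f (part I) (d I) \<sigma> = z I \<sigma>)"
    by metis
  define e where "e I = (if card I = Suc n then d I else c I)" for I
  have less: "e I = c I" if "card I \<le> n" for I using that by (simp add: e_def)
  have "colour_chains e (Suc n)"
    unfolding colour_chains_def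
  proof (intro conjI allI impI)
    show "e {} = (\<lambda>\<sigma>. of_bool (\<sigma> = {}))" using c less[of "{}"] by (simp add: colour_chains_def)
    fix I assume I: "I \<subseteq> M" "card I \<le> Suc n"
    have below: "e (I - {i}) = c (I - {i})" if "i \<in> I" for i
      using that I card_Diff_singleton[of i I] by (intro less) simp
    show "chain (subcomplex I) (card I) (e I)"
    proof (cases "card I = Suc n")
      case True
      then show ?thesis using d[OF I(1) True] by (simp add: e_def)
    next
      case False
      then have "card I \<le> n" using I by simp
      then show ?thesis using c I(1) less[of I] by (simp add: colour_chains_def)
    qed
    fix \<sigma> assume "I \<noteq> {}"
    have "boundary f V (e I) \<sigma> = (\<Sum>i\<in>I. insertion_sign id i (I - {i}) * c (I - {i}) \<sigma>)"
    proof (cases "card I = Suc n")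
      case True
      then show ?thesis using d[OF I(1) True] boundary_part[of I "card I" "d I" \<sigma>] by (simp add: e_def z_def)
    next
      case False
      then have "card I \<le> n" using I by simp
      then show ?thesis using c I(1) \<open>I \<noteq> {}\<close> less[of I] by (simp add: colour_chains_def)
    qed
    then show "boundary f V (e I) \<sigma> = (\<Sum>i\<in>I. insertion_sign id i (I - {i}) * e (I - {i}) \<sigma>)"
      using below by simp
  qed
  then show ?case by blast
qed

text \<open>Remove a colour \<open>j\<close>. By adjointness the rainbow count of \<open>c I\<close> is, up to a sign, that of its boundary against
the colours \<open>J = I - {j}\<close>; in that boundary only \<open>c J\<close> contains simplices using all colours of
\<open>J\<close>, and it enters with the same sign.\<close>

lemma rainbow_pairing:
  assumes c: "colour_chains c (card M)" and "I \<subseteq> M"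
  shows "(\<Sum>\<sigma>\<in>faces X (card I). c I \<sigma> * rainbow colour I \<sigma>) = 1"
  using finite_colours[OF assms(2)] assms(2)
proof (induction I rule: finite_psubset_induct)
  case (psubset I)
  have fin_face: "finite \<sigma>" "\<sigma> \<subseteq> V" if "\<sigma> \<in> X" for \<sigma>
    using X that by (auto simp: finite_complex_def intro: finite_subset)
  have supp: "\<sigma> \<in> X \<and> colour ` \<sigma> \<subseteq> J \<and> card \<sigma> = card J" if "c J \<sigma> \<noteq> 0" "J \<subseteq> M" for J \<sigma>
  proof -
    have "card J \<le> card M" using that(2) finM by (rule_tac card_mono)
    then have "chain (subcomplex J) (card J) (c J)" using c that(2) by (simp add: colour_chains_def)
    then show ?thesis using that(1)
      by (auto simp: chain_def faces_def subcomplex_def induced_complex_def part_def)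
  qed
  show ?case
  proof (cases "I = {}")
    case True
    have "faces X 0 = {{}}" using X fin_face by (auto simp: faces_def finite_complex_def)
    moreover have "c {} {} = 1" using c by (simp add: colour_chains_def)
    moreover have "rainbow colour {} {} = 1" by (simp add: rainbow_def bij_betw_def)
    ultimately show ?thesis using True by simp
  next
    case False
    then obtain j where j: "j \<in> I" by blast
    define J where "J = I - {j}"
    define s where "s = insertion_sign id j J"
    have "j \<notin> J" "J \<subseteq> I" by (simp_all add: J_def)
    then have "J \<noteq> I" using j by metis
    with \<open>J \<subseteq> I\<close> have JI: "J \<subset> I" by (rule psubsetI)
    have JM: "J \<subseteq> M" using \<open>J \<subseteq> I\<close> psubset.prems by (rule subset_trans)
    have cardI: "card I = Suc (card J)" unfolding J_def using card_Suc_Diff1[OF finite_colours[OF psubset.prems] j] by (rule sym)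
    have IM: "card I \<le> card M" using psubset.prems finM by (rule_tac card_mono)
    have chainI: "chain X (Suc (card J)) (c I)"
      using supp psubset.prems cardI by (auto simp: chain_def faces_def)
    have "s * (\<Sum>\<tau>\<in>faces X (card I). c I \<tau> * rainbow colour I \<tau>)
        = (\<Sum>\<tau>\<in>faces X (Suc (card J)). c I \<tau> * coboundary f (rainbow colour J) \<tau>)"
      unfolding sum_distrib_left cardI[symmetric]
    proof (rule sum.cong)
      fix \<tau> assume "\<tau> \<in> faces X (card I)"
      show "s * (c I \<tau> * rainbow colour I \<tau>) = c I \<tau> * coboundary f (rainbow colour J) \<tau>"
      proof (cases "c I \<tau> = 0")
        case False
        then have \<tau>: "\<tau> \<in> X" "colour ` \<tau> \<subseteq> I" "card \<tau> = card I" using supp psubset.prems by blast+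
        have "coboundary f (rainbow colour J) \<tau> = s * rainbow colour I \<tau>"
          unfolding J_def s_def
        proof (rule coboundary_rainbow)
          show "f u < f v" if "u \<in> \<tau>" "v \<in> \<tau>" "colour u < colour v" for u v
            using order that fin_face(2)[OF \<tau>(1)] by blast
          show "inj_on f \<tau>" using inj fin_face(2)[OF \<tau>(1)] by (rule inj_on_subset)
        qed (use \<tau> fin_face j finite_colours[OF psubset.prems] in auto)
        then show ?thesis by simp
      qed simp
    qed simp
    also have "\<dots> = (\<Sum>\<sigma>\<in>faces X (card J). boundary f V (c I) \<sigma> * rainbow colour J \<sigma>)"
      by (rule boundary_coboundary_adjoint[OF X chainI, symmetric])
    also have "\<dots> = (\<Sum>\<sigma>\<in>faces X (card J). s * (c J \<sigma> * rainbow colour J \<sigma>))"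
    proof (rule sum.cong)
      fix \<sigma> assume "\<sigma> \<in> faces X (card J)"
      have "c (I - {i}) \<sigma> * rainbow colour J \<sigma> = 0" if "i \<in> I - {j}" for i
      proof (rule ccontr)
        assume "c (I - {i}) \<sigma> * rainbow colour J \<sigma> \<noteq> 0"
        then have "c (I - {i}) \<sigma> \<noteq> 0" "colour ` \<sigma> = J" by (auto simp: rainbow_def bij_betw_def)
        then have "J \<subseteq> I - {i}" using supp[of "I - {i}" \<sigma>] psubset.prems by blast
        then show False using that by (auto simp: J_def)
      qed
      then have "(\<Sum>i\<in>I. insertion_sign id i (I - {i}) * (c (I - {i}) \<sigma> * rainbow colour J \<sigma>))
          = (\<Sum>i\<in>{j}. insertion_sign id i (I - {i}) * (c (I - {i}) \<sigma> * rainbow colour J \<sigma>))"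
        using j finite_colours[OF psubset.prems] by (intro sum.mono_neutral_right) auto
      moreover have "boundary f V (c I) \<sigma> = (\<Sum>i\<in>I. insertion_sign id i (I - {i}) * c (I - {i}) \<sigma>)"
        using c psubset.prems IM False by (simp add: colour_chains_def)
      ultimately show "boundary f V (c I) \<sigma> * rainbow colour J \<sigma> = s * (c J \<sigma> * rainbow colour J \<sigma>)"
        by (simp add: sum_distrib_right mult.assoc J_def s_def)
    qed simp
    also have "\<dots> = s" using psubset.IH[OF JI JM] by (simp add: sum_distrib_left[symmetric])
    finally have "s * (s * (\<Sum>\<tau>\<in>faces X (card I). c I \<tau> * rainbow colour I \<tau>)) = s * s" by simp
    then show ?thesis unfolding mult.assoc[symmetric] s_def by simp
  qed
qed

text \<open>A homological Hall theorem. Degrees are cardinalities, so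
the hypothesis is the vanishing of the homology of \<open>subcomplex I\<close> in dimension \<open>card I - 2\<close>.\<close>

theorem rainbow_simplex_exists:
  assumes acyclic: "\<And>I z. \<lbrakk>I \<subseteq> M; I \<noteq> {}; chain (subcomplex I) (card I - 1) z;
      \<And>\<eta>. \<eta> \<in> subcomplex I \<Longrightarrow> boundary f (part I) z \<eta> = 0\<rbrakk>
    \<Longrightarrow> \<exists>c. chain (subcomplex I) (card I) c \<and> (\<forall>\<sigma>. boundary f (part I) c \<sigma> = z \<sigma>)"
  shows "\<exists>\<sigma>\<in>X. bij_betw colour \<sigma> M"
proof -
  obtain c where c: "colour_chains c (card M)" using colour_chains_exist[OF acyclic] by blast
  have "(\<Sum>\<sigma>\<in>faces X (card M). c M \<sigma> * rainbow colour M \<sigma>) \<noteq> 0"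
    using rainbow_pairing[OF c, of M] by simp
  then obtain \<sigma> where "\<sigma> \<in> faces X (card M)" "rainbow colour M \<sigma> \<noteq> 0"
    by (metis (no_types, lifting) mult_zero_right sum.neutral)
  then show ?thesis by (auto simp: faces_def rainbow_def)
qed

end

lemma monotone_injective_labelling:
  fixes colour :: "'a \<Rightarrow> nat"
  assumes "finite V"
  obtains f :: "'a \<Rightarrow> nat" where "inj_on f V" "\<And>u v. u \<in> V \<Longrightarrow> v \<in> V \<Longrightarrow> colour u < colour v \<Longrightarrow> f u < f v"
proof -
  obtain g :: "'a \<Rightarrow> nat" and N where g: "g ` V = {i. i < N}" "inj_on g V"
    using finite_imp_inj_to_nat_seg[OF assms] by blast
  define f where "f v = colour v * N + g v" for v
  have less: "f u < f v" if "u \<in> V" "v \<in> V" "colour u < colour v" for u v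
  proof -
    have "g u < N" using g(1) that(1) by auto
    then have "f u < Suc (colour u) * N" by (simp add: f_def)
    also have "\<dots> \<le> colour v * N" using that(3) by (intro mult_right_mono) auto
    finally show ?thesis by (simp add: f_def)
  qed
  have "inj_on f V"
  proof (rule inj_onI)
    fix u v assume uv: "u \<in> V" "v \<in> V" "f u = f v"
    then have "colour u = colour v" using less[of u v] less[of v u] by (cases "colour u" "colour v" rule: linorder_cases) auto
    then have "g u = g v" using uv(3) by (simp add: f_def)
    then show "u = v" using g(2) uv(1,2) by (auto dest: inj_onD)
  qed
  then show ?thesis using less that by blast
qed

section \<open>Colourful simplices\<close>

theorem theorem1p7:
  fixes V :: "'a set" and X :: "'a set set" and m :: nat and Vs :: "nat \<Rightarrow> 'a set"
  assumes "finite_complex V X"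
    and "disjoint_family_on Vs {1..m}"
    and "(\<Union>i\<in>{1..m}. Vs i) = V"
    and "\<And>I. I \<subseteq> {1..m} \<Longrightarrow> I \<noteq> {} \<Longrightarrow>
      vector_domination (\<Union>i\<in>I. Vs i) (induced_complex X (\<Union>i\<in>I. Vs i)) >
      ereal (\<Sum>r\<in>missing_dims (\<Union>i\<in>I. Vs i) (induced_complex X (\<Union>i\<in>I. Vs i)).
        real (r * ((card I - 1) choose r)))"
  shows "\<exists>\<sigma>\<in>X. \<forall>i\<in>{1..m}. card (\<sigma> \<inter> Vs i) = 1"
proof -
  have fin: "finite V" using assms(1) by (simp add: finite_complex_def)
  define colour where "colour v = (THE i. i \<in> {1..m} \<and> v \<in> Vs i)" for v
  have colour: "colour v = i" if "i \<in> {1..m}" "v \<in> Vs i" for i v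
    unfolding colour_def
  proof (rule the_equality)
    show "k = i" if "k \<in> {1..m} \<and> v \<in> Vs k" for k
      using disjoint_family_onD[OF assms(2) \<open>i \<in> {1..m}\<close>, of k] that \<open>v \<in> Vs i\<close> by blast
  qed (use that in blast)
  have colour_iff: "v \<in> Vs i \<longleftrightarrow> v \<in> V \<and> colour v = i" if i: "i \<in> {1..m}" for i v
  proof
    assume "v \<in> Vs i"
    then show "v \<in> V \<and> colour v = i" using i colour assms(3) by blast
  next
    assume v: "v \<in> V \<and> colour v = i"
    then obtain k where "k \<in> {1..m}" "v \<in> Vs k" using assms(3) by blast
    then show "v \<in> Vs i" using v colour by metis
  qed
  obtain f :: "'a \<Rightarrow> nat" where f: "inj_on f V" "\<And>u v. u \<in> V \<Longrightarrow> v \<in> V \<Longrightarrow> colour u < colour v \<Longrightarrow> f u < f v"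
    using monotone_injective_labelling[OF fin] by metis
  interpret coloured_complex V X f colour "{1..m}"
    using assms(1) f by unfold_locales auto
  have part_eq: "part I = (\<Union>i\<in>I. Vs i)" if "I \<subseteq> {1..m}" for I
  proof -
    have "v \<in> Vs i \<longleftrightarrow> v \<in> V \<and> colour v = i" if "i \<in> I" for i v
      using colour_iff \<open>I \<subseteq> {1..m}\<close> that by blast
    then show ?thesis by (auto simp: part_def)
  qed
  have part_V: "part I \<subseteq> V" for I by (auto simp: part_def)
  obtain \<sigma> where \<sigma>: "\<sigma> \<in> X" "bij_betw colour \<sigma> {1..m}"
  proof -
    have "\<exists>c. chain (subcomplex I) (card I) c \<and> (\<forall>\<sigma>. boundary f (part I) c \<sigma> = z \<sigma>)"
      if I: "I \<subseteq> {1..m}" "I \<noteq> {}" and z: "chain (subcomplex I) (card I - 1) z"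
        and cycle: "\<And>\<eta>. \<eta> \<in> subcomplex I \<Longrightarrow> boundary f (part I) z \<eta> = 0" for I z
    proof -
      have "Suc (card I - 1) = card I" using I finite_colours[OF I(1)] by (simp add: card_gt_0_iff)
      moreover have "\<exists>c. chain (subcomplex I) (Suc (card I - 1)) c \<and> (\<forall>\<sigma>. boundary f (part I) c \<sigma> = z \<sigma>)"
      proof (rule large_vector_domination_acyclic[OF _ _ _ z cycle])
        show "finite_complex (part I) (subcomplex I)"
          unfolding subcomplex_def by (rule finite_complex_induced[OF assms(1) part_V])
        show "inj_on f (part I)" using f(1) part_V by (rule inj_on_subset)
        show "ereal (\<Sum>r\<in>missing_dims (part I) (subcomplex I). real (r * ((card I - 1) choose r)))
            < vector_domination (part I) (subcomplex I)"
          unfolding subcomplex_def part_eq[OF I(1)] by (rule assms(4)[OF I])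
      qed
      ultimately show ?thesis by simp
    qed
    then show ?thesis using rainbow_simplex_exists that by blast
  qed
  have "card (\<sigma> \<inter> Vs i) = 1" if i: "i \<in> {1..m}" for i
  proof -
    have "i \<in> colour ` \<sigma>" using \<sigma>(2) i by (simp add: bij_betw_def)
    then obtain v where v: "v \<in> \<sigma>" "colour v = i" by blast
    have "\<sigma> \<subseteq> V" using \<sigma>(1) assms(1) by (auto simp: finite_complex_def)
    then have "\<sigma> \<inter> Vs i = {v}" using v \<sigma>(2) colour_iff[OF i] by (auto simp: bij_betw_def dest: inj_onD)
    then show ?thesis by simp
  qed
  then show ?thesis using \<sigma>(1) by blast
qed

end
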